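(* The direct limit of a directed system $(G_i)_{i\in\mathbb{N}}$ of countable linear sofic groups (with group morphisms as connecting maps) is linear sofic.
   Context: A countable group is linear sofic if it admits an injective group morphism into $\prod_{k\to\omega}GL_{n_k}(\mathbb{C})/d_\omega$ for some non-principal ultrafilter $\omega$ on $\mathbb{N}$ and $n_k\to\infty$, where this is the quotient of $\prod_kGL_{n_k}(\mathbb{C})$ by $\{(a_k)_k:\lim_{k\to\omega}\rho(a_k-\mathrm{Id})=0\}$ and $\rho(a)=\operatorname{rk}(a)/n$ for $a\in M_n(\mathbb{C})$. *)

theory Defs
  imports "Jordan_Normal_Form.DL_Rank" "HOL-Algebra.Coset" "HOL-Library.Countable_Set"
begin

definition rho :: "nat \<Rightarrow> complex mat \<Rightarrow> real" where
  "rho n a = real (vec_space.rank n a) / real n"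

definition GLprod :: "(nat \<Rightarrow> nat) \<Rightarrow> (nat \<Rightarrow> complex mat) monoid" where
  "GLprod n = \<lparr>carrier = {a. \<forall>k. a k \<in> carrier_mat (n k) (n k) \<and> invertible_mat (a k)},
              monoid.mult = (\<lambda>a b k. a k * b k),
              one = (\<lambda>k. 1\<^sub>m (n k))\<rparr>"

definition d_kernel :: "(nat \<Rightarrow> nat) \<Rightarrow> nat filter \<Rightarrow> (nat \<Rightarrow> complex mat) set" where
  "d_kernel n \<omega> = {a \<in> carrier (GLprod n).
      ((\<lambda>k. rho (n k) (a k - 1\<^sub>m (n k))) \<longlongrightarrow> 0) \<omega>}"

definition GL_ultraproduct :: "(nat \<Rightarrow> nat) \<Rightarrow> nat filter \<Rightarrow> (nat \<Rightarrow> complex mat) set monoid" where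
  "GL_ultraproduct n \<omega> = GLprod n Mod d_kernel n \<omega>"

definition nonprincipal_ultrafilter :: "nat filter \<Rightarrow> bool" where
  "nonprincipal_ultrafilter \<omega> \<longleftrightarrow>
     \<omega> \<noteq> bot \<and> (\<forall>P. eventually P \<omega> \<or> eventually (\<lambda>x. \<not> P x) \<omega>) \<and>
     (\<forall>x. \<omega> \<noteq> principal {x})"

definition linear_sofic :: "('a, 'b) monoid_scheme \<Rightarrow> bool" where
  "linear_sofic G \<longleftrightarrow> group G \<and> countable (carrier G) \<and>
     (\<exists>\<omega> n. nonprincipal_ultrafilter \<omega> \<and> filterlim n at_top sequentially \<and>
        (\<exists>h. h \<in> hom G (GL_ultraproduct n \<omega>) \<and> inj_on h (carrier G)))"

definition directed_system :: "(nat \<Rightarrow> 'a monoid) \<Rightarrow> (nat \<Rightarrow> nat \<Rightarrow> 'a \<Rightarrow> 'a) \<Rightarrow> bool" where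
  "directed_system G f \<longleftrightarrow>
     (\<forall>i. group (G i)) \<and>
     (\<forall>i j. i \<le> j \<longrightarrow> f i j \<in> hom (G i) (G j)) \<and>
     (\<forall>i. \<forall>x \<in> carrier (G i). f i i x = x) \<and>
     (\<forall>i j k. i \<le> j \<longrightarrow> j \<le> k \<longrightarrow> (\<forall>x \<in> carrier (G i). f j k (f i j x) = f i k x))"

definition dlim_rel :: "(nat \<Rightarrow> 'a monoid) \<Rightarrow> (nat \<Rightarrow> nat \<Rightarrow> 'a \<Rightarrow> 'a) \<Rightarrow> ((nat \<times> 'a) \<times> (nat \<times> 'a)) set" where
  "dlim_rel G f = {((i, x), (j, y)). x \<in> carrier (G i) \<and> y \<in> carrier (G j) \<and>
       (\<exists>k. i \<le> k \<and> j \<le> k \<and> f i k x = f j k y)}"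

definition direct_limit :: "(nat \<Rightarrow> 'a monoid) \<Rightarrow> (nat \<Rightarrow> nat \<Rightarrow> 'a \<Rightarrow> 'a) \<Rightarrow> (nat \<times> 'a) set monoid" where
  "direct_limit G f = \<lparr>carrier = (SIGMA i:UNIV. carrier (G i)) // dlim_rel G f,
     monoid.mult = (\<lambda>A B. let (i, x) = (SOME p. p \<in> A); (j, y) = (SOME q. q \<in> B); m = max i j
                          in dlim_rel G f `` {(m, f i m x \<otimes>\<^bsub>G m\<^esub> f j m y)}),
     one = dlim_rel G f `` {(0, \<one>\<^bsub>G 0\<^esub>)}\<rparr>"

end

(*
Proof idea. The limit embeds locally into the groups G j, but the ranks of the images of a fixed
non-trivial element could tend to 0 with j, so one first needs a uniform lower bound. For invertible
a with d = rho (a - 1) the tensor square satisfies rho (a \<otimes> a - 1) \<ge> 2 d (1 - d), which exceeds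
3/2 d as long as d < 1/4. Hence finitely many tensor squarings turn an almost representation in
which a given g is at positive distance from 1 into one where this distance is at least 1/4, at the
price of a controlled factor in the defect. Averaging almost representations by block sums
a \<otimes> 1 \<oplus> 1 \<otimes> b then separates the t-th of finitely many elements from 1 by 1/(8 * 2^t), a bound
independent of j, and a diagonal sequence of such almost representations is the required embedding.
*)
theory Submission
  imports Defs
begin

subsection \<open>Rank of matrices over a field\<close>

text \<open>For permutation matrices the proportion of fixed points is multiplicative under tensor
  products, so tensor powers only increase the distance to 1. Rank has no such formula, and squaring
  can destroy distance altogether: a = -1 has d = 1, yet a \<otimes> a = 1. The bound 2 d (1 - d)
  reflects this by vanishing at d = 1. Squaring must therefore stop for each element as soon as d
  \<ge> 1/4, and different elements need different numbers of squarings. This is why elements are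
  amplified one at a time and combined afterwards, instead of amplifying a single almost
  representation for all of them.

  The order of choices matters as well. An embedding of \<open>G j\<close> gives, for a fixed g, a
  positive distance \<delta> over which there is no control, but which does not depend on the defect
  still to be requested. The number M of squarings depends on \<delta> alone, so a defect 2^M times
  smaller can be requested afterwards. Almost representations are finite-dimensional data that no
  longer mention an ultrafilter, so it does not matter that the ultrafilters of the groups
  \<open>G j\<close> may differ.\<close>

text \<open>The row count that \<open>vec_space.rank\<close> expects as an argument is read off the
  matrix, so that statements about products of rectangular matrices need no explicit
  dimensions.\<close>

definition mrank :: "'a::field mat \<Rightarrow> nat" where
  "mrank A = vec_space.rank (dim_row A) A"

lemma mrank_eq_rank: "A \<in> carrier_mat n m \<Longrightarrow> mrank A = vec_space.rank n A"
  by (simp add: mrank_def)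

lemma (in vec_space) maximal_lin_indpt_spans:
  assumes "maximal S (\<lambda>T. T \<subseteq> C \<and> lin_indpt T)" "C \<subseteq> carrier_vec n"
  shows "C \<subseteq> span S"
proof
  fix v assume v: "v \<in> C"
  have S: "S \<subseteq> C" "lin_indpt S" using assms(1) by (auto simp: maximal_def)
  have SV: "S \<subseteq> carrier_vec n" using S(1) assms(2) by blast
  show "v \<in> span S"
  proof (cases "v \<in> S")
    case True
    then show ?thesis using SV in_own_span[of S] by auto
  next
    case False
    have "lin_dep (S \<union> {v})"
    proof (rule ccontr)
      assume "\<not> lin_dep (S \<union> {v})"
      then have "S \<union> {v} \<subseteq> C \<and> lin_indpt (S \<union> {v})" using S v by blast
      then have "S \<union> {v} = S" using assms(1) unfolding maximal_def by blast
      then show False using False by blast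
    qed
    then show ?thesis using lin_dep_iff_in_span[OF SV S(2) _ False] v assms(2) by blast
  qed
qed

text \<open>Rank factorization: the columns of \<open>P\<close> are a maximal independent set of
  columns of \<open>A\<close>, and column j of \<open>Q\<close> holds the coordinates of column j of
  \<open>A\<close> with respect to them.\<close>

lemma mrank_factorization:
  assumes A: "A \<in> carrier_mat n m"
  obtains P Q where "P \<in> carrier_mat n (mrank A)" "Q \<in> carrier_mat (mrank A) m" "A = P * Q"
proof -
  interpret vec_space "TYPE('a)" n .
  have C: "set (cols A) \<subseteq> carrier_vec n" using cols_dim A by blast
  obtain S where S: "maximal S (\<lambda>T. T \<subseteq> set (cols A) \<and> lin_indpt T)" "finite S"
    using maximal_exists_superset[of "set (cols A)" "\<lambda>T. T \<subseteq> set (cols A) \<and> lin_indpt T" "{}"]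
    using finite_lin_indpt2[of "{}"] by auto
  then have card: "mrank A = card S" using rank_card_indpt[OF A] by (simp add: mrank_eq_rank[OF A])
  obtain ws where ws: "set ws = S" "distinct ws" using finite_distinct_list[OF S(2)] by blast
  have len: "length ws = mrank A" using card ws distinct_card by metis
  have Sn: "set ws \<subseteq> carrier_vec n" using S(1) C ws(1) by (auto simp: maximal_def)
  have "\<exists>c. col A j = mat_of_cols n ws *\<^sub>v vec (length ws) c" if "j < m" for j
  proof -
    have "col A j \<in> set (cols A)" using that A by (metis carrier_matD(2) cols_length cols_nth nth_mem)
    then have "col A j \<in> span_list ws"
      using maximal_lin_indpt_spans[OF S(1) C] span_list_as_span[OF Sn] ws(1) by blast
    then obtain c where "col A j = lincomb_list c ws" by (auto simp: span_list_def)
    then show ?thesis using lincomb_list_as_mat_mult Sn by (metis carrier_vecD subsetD)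
  qed
  then obtain c where c: "\<And>j. j < m \<Longrightarrow> col A j = mat_of_cols n ws *\<^sub>v vec (length ws) (c j)" by metis
  define Q where "Q = mat (length ws) m (\<lambda>(i,j). c j i)"
  have "A = mat_of_cols n ws * Q"
  proof (rule eq_matI)
    fix i j assume "i < dim_row (mat_of_cols n ws * Q)" "j < dim_col (mat_of_cols n ws * Q)"
    then have ij: "i < n" "j < m" by (auto simp: Q_def)
    have "A $$ (i,j) = col A j $ i" using ij A by auto
    also have "\<dots> = row (mat_of_cols n ws) i \<bullet> vec (length ws) (c j)" using ij by (simp add: c)
    also have "vec (length ws) (c j) = col Q j" using ij by (auto simp: Q_def)
    finally show "A $$ (i,j) = (mat_of_cols n ws * Q) $$ (i,j)" using ij by (simp add: Q_def)
  qed (use A in \<open>auto simp: Q_def\<close>)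
  moreover have "mat_of_cols n ws \<in> carrier_mat n (mrank A)" using len by auto
  moreover have "Q \<in> carrier_mat (mrank A) m" using len by (auto simp: Q_def)
  ultimately show ?thesis using that by blast
qed

text \<open>The product is a sum of r outer products, each a column of \<open>P\<close> times a row
  of \<open>Q\<close> and hence of rank at most 1; the induction adds them one by one. With
  \<open>mrank_factorization\<close> this characterizes rank as the least inner dimension, the
  source of all upper bounds for products.\<close>

lemma mrank_mult_le_inner:
  assumes P: "P \<in> carrier_mat n r" and Q: "Q \<in> carrier_mat r m"
  shows "mrank (P * Q) \<le> r"
proof -
  interpret vec_space "TYPE('a)" n .
  have "k \<le> r \<Longrightarrow> rank (mat n m (\<lambda>(i,j). \<Sum>l<k. P $$ (i,l) * Q $$ (l,j))) \<le> k" for k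
  proof (induction k)
    case 0
    have zero: "mat n m (\<lambda>(i,j). \<Sum>l<0. P $$ (i,l) * Q $$ (l,j)) = 0\<^sub>m n m" by auto
    show ?case unfolding zero by (simp add: rank_0I)
  next
    case (Suc k)
    let ?M = "\<lambda>k. mat n m (\<lambda>(i,j). \<Sum>l<k. P $$ (i,l) * Q $$ (l,j))"
    let ?N = "mat n m (\<lambda>(i,j). P $$ (i,k) * Q $$ (k,j))"
    have "?M (Suc k) = ?M k + ?N" by auto
    moreover have "rank ?N \<le> 1"
      by (rule rank_le_1_product_entries[where f="\<lambda>i. P $$ (i,k)" and g="\<lambda>j. Q $$ (k,j)"]) auto
    moreover have "rank (?M k + ?N) \<le> rank (?M k) + rank ?N" by (rule rank_subadditive) auto
    ultimately show ?case using Suc by auto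
  qed
  from this[of r] have "rank (mat n m (\<lambda>(i,j). \<Sum>l<r. P $$ (i,l) * Q $$ (l,j))) \<le> r" by simp
  moreover have "P * Q = mat n m (\<lambda>(i,j). \<Sum>l<r. P $$ (i,l) * Q $$ (l,j))"
    using P Q by (auto simp: scalar_prod_def atLeast0LessThan)
  ultimately show ?thesis using mrank_eq_rank[of "P * Q" n m] P Q by auto
qed

lemma mrank_mult_le_left:
  assumes "A \<in> carrier_mat n m" "B \<in> carrier_mat m k"
  shows "mrank (A * B) \<le> mrank A"
proof -
  obtain P Q where PQ: "P \<in> carrier_mat n (mrank A)" "Q \<in> carrier_mat (mrank A) m" "A = P * Q"
    using mrank_factorization assms(1) by blast
  have "A * B = P * (Q * B)" using PQ assms by (metis assoc_mult_mat)
  then show ?thesis using mrank_mult_le_inner[of P n "mrank A" "Q * B" k] PQ(1,2) assms by simp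
qed

lemma mrank_mult_le_right:
  assumes "A \<in> carrier_mat n m" "B \<in> carrier_mat m k"
  shows "mrank (A * B) \<le> mrank B"
proof -
  obtain P Q where PQ: "P \<in> carrier_mat m (mrank B)" "Q \<in> carrier_mat (mrank B) k" "B = P * Q"
    using mrank_factorization assms(2) by blast
  have "A * B = (A * P) * Q" using PQ assms by (metis assoc_mult_mat)
  then show ?thesis using mrank_mult_le_inner[of "A * P" n "mrank B" Q k] PQ(1,2) assms by simp
qed

lemma mrank_le_dim_row: "A \<in> carrier_mat n m \<Longrightarrow> mrank A \<le> n"
  using mrank_mult_le_inner[of "1\<^sub>m n" n n A m] by simp

lemma mrank_one [simp]: "mrank (1\<^sub>m n :: 'a::field mat) = n"
  using vec_space.det_rank_iff[of "1\<^sub>m n :: 'a mat" n] by (simp add: mrank_def)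

lemma mrank_zero [simp]: "mrank (0\<^sub>m n m :: 'a::field mat) = 0"
  using vec_space.rank_0I by (simp add: mrank_def)

lemma mrank_add_le:
  "A \<in> carrier_mat n m \<Longrightarrow> B \<in> carrier_mat n m \<Longrightarrow> mrank (A + B) \<le> mrank A + mrank B"
  using vec_space.rank_subadditive[of A n m B] by (simp add: mrank_def)

lemma mrank_uminus:
  assumes "A \<in> carrier_mat n m" shows "mrank (- A) = mrank (A :: 'a::field mat)"
proof -
  have *: "mrank (- B) \<le> mrank B" if "B \<in> carrier_mat n m" for B :: "'a mat"
  proof -
    have "- B = (- 1\<^sub>m n) * B" using that by simp
    then show ?thesis using mrank_mult_le_right[of "- 1\<^sub>m n" n n B m] that by simp
  qed
  from *[OF assms] *[of "- A"] assms show ?thesis by simp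
qed

section \<open>Identity compressions and the Frobenius inequality\<close>

text \<open>The certificate for lower bounds, dual to factorizations for upper bounds: compressing
  \<open>A\<close> to an identity of size r shows that its rank is at least r. The bounds for
  Kronecker products and block sums and the Frobenius inequality all rest on it.\<close>

lemma mrank_ge_of_identity:
  assumes "X \<in> carrier_mat r n" "A \<in> carrier_mat n m" "Y \<in> carrier_mat m r" "X * A * Y = 1\<^sub>m r"
  shows "r \<le> mrank A"
proof -
  have "r = mrank (X * A * Y)" using assms(4) by simp
  also have "\<dots> \<le> mrank (X * A)" using assms by (intro mrank_mult_le_left[of _ r m _ r]) auto
  also have "\<dots> \<le> mrank A" using assms by (intro mrank_mult_le_right) auto
  finally show ?thesis .
qed

text \<open>Stacking \<open>U\<close> under \<open>X\<close> and putting \<open>W\<close> beside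
  \<open>Y\<close> compresses \<open>A\<close> to the unit lower triangular block matrix with rows
  (1, 0) and (C, 1), where C = U A Y. One block row operation, replacing \<open>U\<close> by U - C
  X, clears C; it leaves the last block alone because X A W = 0.\<close>

lemma identity_compression_extend:
  fixes A :: "'a::field mat"
  assumes A: "A \<in> carrier_mat n m"
    and X: "X \<in> carrier_mat r n" and Y: "Y \<in> carrier_mat m r" and XAY: "X * (A * Y) = 1\<^sub>m r"
    and U: "U \<in> carrier_mat s n" and W: "W \<in> carrier_mat m s" and UAW: "U * (A * W) = 1\<^sub>m s"
    and XAW: "X * (A * W) = 0\<^sub>m r s"
  obtains X' Y' where "X' \<in> carrier_mat (r + s) n" "Y' \<in> carrier_mat m (r + s)"
    "X' * (A * Y') = 1\<^sub>m (r + s)"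
proof -
  define C where "C = U * (A * Y)"
  have C: "C \<in> carrier_mat s r" using assms by (simp add: C_def)
  define U' where "U' = U - C * X"
  have U': "U' \<in> carrier_mat s n" unfolding U'_def using C X by (intro minus_carrier_mat mult_carrier_mat)
  \<comment> \<open>The blocks of width or height 0 turn \<open>four_block_mat\<close> into plain
    vertical or horizontal stacking; \<open>A\<close> is padded in the same way so that the block
    product rule applies.\<close>
  define X' where "X' = four_block_mat X (0\<^sub>m r 0) U' (0\<^sub>m s 0)"
  define Y' where "Y' = four_block_mat Y W (0\<^sub>m 0 r) (0\<^sub>m 0 s)"
  define Z where "Z = four_block_mat (A * Y) (A * W) (0\<^sub>m 0 r) (0\<^sub>m 0 s)"
  have "A = four_block_mat A (0\<^sub>m n 0) (0\<^sub>m 0 m) (0\<^sub>m 0 0)"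
    using A by auto
  then have "A * Y' = four_block_mat A (0\<^sub>m n 0) (0\<^sub>m 0 m) (0\<^sub>m 0 0) * Y'" by simp
  also have "\<dots> = Z" unfolding Y'_def Z_def using A Y W
    by (subst mult_four_block_mat[where ?nr1.0=n and ?n1.0=m and ?n2.0=0 and ?nr2.0=0 and ?nc1.0=r and ?nc2.0=s])
       auto
  finally have AY': "A * Y' = Z" .
  have U'AY: "U' * (A * Y) = 0\<^sub>m s r"
  proof -
    have "U' * (A * Y) = U * (A * Y) - C * X * (A * Y)"
      unfolding U'_def using A X Y U C by (intro minus_mult_distrib_mat) auto
    also have "C * X * (A * Y) = C * (X * (A * Y))"
      using A X Y C by (intro assoc_mult_mat) auto
    also have "\<dots> = C" using C XAY by simp
    finally show ?thesis using C by (simp add: C_def[symmetric])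
  qed
  have U'AW: "U' * (A * W) = 1\<^sub>m s"
  proof -
    have "U' * (A * W) = U * (A * W) - C * X * (A * W)"
      unfolding U'_def using A X W U C by (intro minus_mult_distrib_mat) auto
    also have "C * X * (A * W) = C * (X * (A * W))"
      using A X W C by (intro assoc_mult_mat) auto
    also have "\<dots> = 0\<^sub>m s s" using C XAW by simp
    also have "U * (A * W) - 0\<^sub>m s s = 1\<^sub>m s" unfolding UAW by (rule eq_matI) auto
    finally show ?thesis .
  qed
  have "X' * Z = four_block_mat (X * (A * Y)) (X * (A * W)) (U' * (A * Y)) (U' * (A * W))"
    unfolding X'_def Z_def using A X Y U' W
    by (subst mult_four_block_mat[where ?nr1.0=r and ?n1.0=n and ?n2.0=0 and ?nr2.0=s and ?nc1.0=r and ?nc2.0=s])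
       (auto intro!: cong_four_block_mat)
  also have "\<dots> = 1\<^sub>m (r + s)" using XAY XAW U'AY U'AW by simp
  finally have "X' * (A * Y') = 1\<^sub>m (r + s)" using AY' by simp
  moreover have "X' \<in> carrier_mat (r + s) n" "Y' \<in> carrier_mat m (r + s)"
    using X U' Y W by (auto simp: X'_def Y'_def)
  ultimately show ?thesis using that by blast
qed

text \<open>Take an identity compression of the largest possible size r. If A - A Y X A were
  nonzero, one of its entries would allow an extension to size r + 1. Hence A = A Y X A, so
  \<open>Y * X\<close> is a generalized inverse of \<open>A\<close>, and this factorization through
  dimension r forces r to be the rank.\<close>

lemma mrank_compression:
  fixes A :: "'a::field mat"
  assumes A: "A \<in> carrier_mat n m"
  obtains X Y where "X \<in> carrier_mat (mrank A) n" "Y \<in> carrier_mat m (mrank A)"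
    "X * (A * Y) = 1\<^sub>m (mrank A)" "A = (A * Y) * (X * A)"
proof -
  define P where "P r \<longleftrightarrow> (\<exists>X Y. X \<in> carrier_mat r n \<and> Y \<in> carrier_mat m r \<and> X * (A * Y) = 1\<^sub>m r)" for r
  have bound: "r \<le> mrank A" if "P r" for r
  proof -
    from that obtain X Y where XY: "X \<in> carrier_mat r n" "Y \<in> carrier_mat m r" "X * (A * Y) = 1\<^sub>m r"
      by (auto simp: P_def)
    then have "X * A * Y = 1\<^sub>m r" using assoc_mult_mat[OF XY(1) A XY(2)] by simp
    then show ?thesis using mrank_ge_of_identity XY A by blast
  qed
  have "P 0" unfolding P_def by (rule exI[of _ "0\<^sub>m 0 n"], rule exI[of _ "0\<^sub>m m 0"]) (use A in auto)
  then obtain r where r: "P r" and max: "\<And>s. P s \<Longrightarrow> s \<le> r"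
    using bound Greatest_le_nat[of P _ "mrank A"] GreatestI_nat[of P 0 "mrank A"] by blast
  from r obtain X Y where X: "X \<in> carrier_mat r n" and Y: "Y \<in> carrier_mat m r"
    and XAY: "X * (A * Y) = 1\<^sub>m r" by (auto simp: P_def)
  \<comment> \<open>\<open>B\<close> is what is left of \<open>A\<close> once the part seen by
    \<open>X\<close> and \<open>Y\<close> is split off; in particular X B = 0.\<close>
  define B where "B = A - (A * Y) * (X * A)"
  have B: "B \<in> carrier_mat n m" using A X Y unfolding B_def by auto
  have XB: "X * B = 0\<^sub>m r m"
  proof -
    have "X * B = X * A - X * ((A * Y) * (X * A))"
      unfolding B_def using A X Y by (intro mult_minus_distrib_mat) auto
    also have "X * ((A * Y) * (X * A)) = X * (A * Y) * (X * A)"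
      using A X Y by (intro assoc_mult_mat[symmetric]) auto
    finally show ?thesis using XAY A X by simp
  qed
  have "B = 0\<^sub>m n m"
  proof (rule ccontr)
    assume "B \<noteq> 0\<^sub>m n m"
    then obtain i j where ij: "i < n" "j < m" "B $$ (i,j) \<noteq> 0" using B by (metis carrier_matD eq_matI index_zero_mat)
    \<comment> \<open>\<open>U\<close> reads off row i, scaled by the inverse of the chosen entry of
      \<open>B\<close>, and \<open>F\<close> selects column j, so U B F = 1.\<close>
    define U :: "'a mat" where "U = mat 1 n (\<lambda>(_,k). if k = i then 1 / B $$ (i,j) else 0)"
    define F :: "'a mat" where "F = mat m 1 (\<lambda>(k,_). if k = j then 1 else 0)"
    \<comment> \<open>The correction of \<open>F\<close> makes A W = B F, so X A W = X B F = 0 as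
      the extension step requires.\<close>
    define W where "W = F - Y * (X * A) * F"
    have car: "U \<in> carrier_mat 1 n" "F \<in> carrier_mat m 1" by (auto simp: U_def F_def)
    then have W: "W \<in> carrier_mat m 1" using A X Y unfolding W_def by (intro minus_carrier_mat mult_carrier_mat)
    have "A * W = A * F - A * (Y * (X * A) * F)"
      unfolding W_def using A X Y car by (intro mult_minus_distrib_mat) auto
    also have "A * (Y * (X * A) * F) = A * (Y * (X * A)) * F"
      using A X Y car by (intro assoc_mult_mat[symmetric]) auto
    also have "A * (Y * (X * A)) = A * Y * (X * A)" using A X Y by (intro assoc_mult_mat[symmetric]) auto
    also have "A * F - A * Y * (X * A) * F = B * F"
      unfolding B_def using A X Y car by (intro minus_mult_distrib_mat[symmetric]) auto
    finally have AW: "A * W = B * F" .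
    have BF: "B * F = mat n 1 (\<lambda>(k,_). B $$ (k,j))"
      using B ij by (auto simp: F_def scalar_prod_def if_distrib cong: if_cong)
    have UAW: "U * (A * W) = 1\<^sub>m 1"
      unfolding AW BF using ij by (auto simp: U_def scalar_prod_def if_distribR if_distrib cong: if_cong)
    have "X * (B * F) = X * B * F" using X B car by (intro assoc_mult_mat[symmetric]) auto
    then have XAW: "X * (A * W) = 0\<^sub>m r 1" unfolding AW using XB car by simp
    obtain X' Y' where "X' \<in> carrier_mat (r + 1) n" "Y' \<in> carrier_mat m (r + 1)"
      "X' * (A * Y') = 1\<^sub>m (r + 1)"
      using identity_compression_extend[OF A X Y XAY car(1) W UAW XAW] by blast
    then have "P (r + 1)" by (auto simp: P_def)
    from max[OF this] show False by simp
  qed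
  have eq: "A = (A * Y) * (X * A)"
  proof (rule eq_matI)
    fix i j assume "i < dim_row (A * Y * (X * A))" "j < dim_col (A * Y * (X * A))"
    then have ij: "i < n" "j < m" using A by auto
    have "B $$ (i,j) = 0" using \<open>B = 0\<^sub>m n m\<close> ij by simp
    then show "A $$ (i, j) = (A * Y * (X * A)) $$ (i, j)" unfolding B_def using A X Y ij by simp
  qed (use A in auto)
  have "mrank A = mrank ((A * Y) * (X * A))" using eq by simp
  also have "\<dots> \<le> r" using A X Y by (intro mrank_mult_le_inner[of _ n _ _ m]) auto
  finally have "r = mrank A" using bound[OF r] by simp
  then show ?thesis using that[of X Y] X Y XAY eq by blast
qed

text \<open>The Frobenius rank inequality in the case where the triple product vanishes. Identity
  compressions of X T and of T Y are both compressions of \<open>T\<close>; the mixed block contains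
  the factor X T Y = 0, so they combine into one of size equal to the sum of the ranks.\<close>

lemma mrank_Frobenius:
  fixes T :: "'a::field mat"
  assumes X: "X \<in> carrier_mat p n" and T: "T \<in> carrier_mat n m" and Y: "Y \<in> carrier_mat m q"
    and XTY: "X * (T * Y) = 0\<^sub>m p q"
  shows "mrank (X * T) + mrank (T * Y) \<le> mrank T"
proof -
  obtain X1 Y1 where 1: "X1 \<in> carrier_mat (mrank (X * T)) p" "Y1 \<in> carrier_mat m (mrank (X * T))"
    "X1 * (X * T * Y1) = 1\<^sub>m (mrank (X * T))"
    using mrank_compression[OF mult_carrier_mat[OF X T]] by metis
  obtain X2 Y2 where 2: "X2 \<in> carrier_mat (mrank (T * Y)) n" "Y2 \<in> carrier_mat q (mrank (T * Y))"
    "X2 * (T * Y * Y2) = 1\<^sub>m (mrank (T * Y))"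
    using mrank_compression[OF mult_carrier_mat[OF T Y]] by metis
  let ?r = "mrank (X * T)" and ?s = "mrank (T * Y)"
  have car: "X1 * X \<in> carrier_mat ?r n" "Y * Y2 \<in> carrier_mat m ?s" using X Y 1 2 by auto
  have "X1 * X * (T * Y1) = X1 * (X * (T * Y1))" using X T 1 by (intro assoc_mult_mat) auto
  also have "X * (T * Y1) = X * T * Y1" using X T 1 by (intro assoc_mult_mat[symmetric]) auto
  finally have e1: "X1 * X * (T * Y1) = 1\<^sub>m ?r" using 1 by simp
  have TYY: "T * (Y * Y2) = T * Y * Y2" using Y T 2 by (intro assoc_mult_mat[symmetric]) auto
  have e2: "X2 * (T * (Y * Y2)) = 1\<^sub>m ?s" unfolding TYY using 2 by simp
  have "X1 * X * (T * Y * Y2) = X1 * (X * (T * Y * Y2))" using X T Y 1 2 by (intro assoc_mult_mat) auto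
  also have "X * (T * Y * Y2) = X * (T * Y) * Y2" using X T Y 2 by (intro assoc_mult_mat[symmetric]) auto
  finally have e3: "X1 * X * (T * (Y * Y2)) = 0\<^sub>m ?r ?s" unfolding TYY XTY using 1 2 by simp
  obtain X' Y' where XY': "X' \<in> carrier_mat (?r + ?s) n" "Y' \<in> carrier_mat m (?r + ?s)"
    "X' * (T * Y') = 1\<^sub>m (?r + ?s)"
    using identity_compression_extend[OF T car(1) 1(2) e1 2(1) car(2) e2 e3] by blast
  have "X' * T * Y' = 1\<^sub>m (?r + ?s)" using assoc_mult_mat[OF XY'(1) T XY'(2)] XY'(3) by simp
  then show ?thesis using mrank_ge_of_identity XY' T by blast
qed

subsection \<open>Kronecker products\<close>

definition kron :: "'a::semiring_1 mat \<Rightarrow> 'a mat \<Rightarrow> 'a mat" where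
  "kron A B = mat (dim_row A * dim_row B) (dim_col A * dim_col B)
     (\<lambda>(i,j). A $$ (i div dim_row B, j div dim_col B) * B $$ (i mod dim_row B, j mod dim_col B))"

lemma kron_carrier [simp, intro]:
  "A \<in> carrier_mat n m \<Longrightarrow> B \<in> carrier_mat n' m' \<Longrightarrow> kron A B \<in> carrier_mat (n * n') (m * m')"
  by (auto simp: kron_def)

lemma div_mod_less_mult: "(i::nat) < n * m \<Longrightarrow> i div m < n \<and> i mod m < m"
  by (metis less_mult_imp_div_less mod_less_divisor mult_0_right not_less_zero gr0I)

lemma index_kron:
  assumes "A \<in> carrier_mat n m" "B \<in> carrier_mat n' m'" "i < n * n'" "j < m * m'"
  shows "kron A B $$ (i,j) = A $$ (i div n', j div m') * B $$ (i mod n', j mod m')"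
  using assms by (auto simp: kron_def)

text \<open>The range is cut into m consecutive intervals of length k. This turns the inner sum of a
  product of Kronecker products into a double sum, which then factors.\<close>

lemma sum_lessThan_mult_div_mod:
  fixes f :: "nat \<Rightarrow> nat \<Rightarrow> 'a::comm_monoid_add"
  shows "(\<Sum>l<m * k. f (l div k) (l mod k)) = (\<Sum>p<m. \<Sum>q<k. f p q)"
proof -
  have "(\<Sum>l<m * k. f (l div k) (l mod k)) = (\<Sum>p<m. \<Sum>l\<in>{p * k..<p * k + k}. f (l div k) (l mod k))"
    by (rule sum.nat_group[symmetric])
  also have "\<dots> = (\<Sum>p<m. \<Sum>q<k. f p q)"
  proof (rule sum.cong[OF refl])
    fix p
    have "(\<Sum>l\<in>{p * k..<p * k + k}. f (l div k) (l mod k)) = (\<Sum>q\<in>{0..<k}. f ((q + p * k) div k) ((q + p * k) mod k))"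
      using sum.shift_bounds_nat_ivl[of "\<lambda>l. f (l div k) (l mod k)" 0 "p * k" k] by (simp add: add.commute)
    also have "\<dots> = (\<Sum>q<k. f p q)" by (simp add: atLeast0LessThan)
    finally show "(\<Sum>l\<in>{p * k..<p * k + k}. f (l div k) (l mod k)) = (\<Sum>q<k. f p q)" .
  qed
  finally show ?thesis .
qed

lemma kron_mult:
  fixes A :: "'a::comm_semiring_1 mat"
  assumes A: "A \<in> carrier_mat n m" and B: "B \<in> carrier_mat n' m'"
    and C: "C \<in> carrier_mat m k" and D: "D \<in> carrier_mat m' k'"
  shows "kron A B * kron C D = kron (A * C) (B * D)"
proof (rule eq_matI)
  fix i j assume "i < dim_row (kron (A * C) (B * D))" "j < dim_col (kron (A * C) (B * D))"
  then have ij: "i < n * n'" "j < k * k'" using assms by (auto simp: kron_def)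
  note dm = div_mod_less_mult[OF ij(1)] div_mod_less_mult[OF ij(2)]
  have "(kron A B * kron C D) $$ (i,j) = (\<Sum>l<m * m'. kron A B $$ (i,l) * kron C D $$ (l,j))"
    using ij kron_carrier[OF A B] kron_carrier[OF C D]
    by (simp add: scalar_prod_def atLeast0LessThan del: kron_carrier)
  also have "\<dots> = (\<Sum>l<m * m'. (A $$ (i div n', l div m') * C $$ (l div m', j div k')) *
       (B $$ (i mod n', l mod m') * D $$ (l mod m', j mod k')))"
    using ij assms by (intro sum.cong) (auto simp: index_kron[OF A B] index_kron[OF C D] ac_simps)
  also have "\<dots> = (\<Sum>p<m. \<Sum>q<m'. (A $$ (i div n', p) * C $$ (p, j div k')) *
       (B $$ (i mod n', q) * D $$ (q, j mod k')))"
    by (rule sum_lessThan_mult_div_mod)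
  also have "\<dots> = (\<Sum>p<m. A $$ (i div n', p) * C $$ (p, j div k')) *
       (\<Sum>q<m'. B $$ (i mod n', q) * D $$ (q, j mod k'))"
    by (rule sum_product[symmetric])
  also have "\<dots> = (A * C) $$ (i div n', j div k') * (B * D) $$ (i mod n', j mod k')"
    using dm assms by (auto simp: scalar_prod_def atLeast0LessThan)
  also have "\<dots> = kron (A * C) (B * D) $$ (i,j)"
    using index_kron[OF mult_carrier_mat[OF A C] mult_carrier_mat[OF B D] ij] by simp
  finally show "(kron A B * kron C D) $$ (i,j) = kron (A * C) (B * D) $$ (i,j)" .
qed (use assms in \<open>auto simp: kron_def\<close>)

lemma kron_one: "kron (1\<^sub>m n) (1\<^sub>m m) = (1\<^sub>m (n * m) :: 'a::semiring_1 mat)"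
proof (rule eq_matI)
  fix i j assume ij: "i < dim_row (1\<^sub>m (n * m) :: 'a mat)" "j < dim_col (1\<^sub>m (n * m) :: 'a mat)"
  then have dm: "i div m < n \<and> i mod m < m" "j div m < n \<and> j mod m < m"
    using div_mod_less_mult by auto
  have "i = j \<longleftrightarrow> i div m = j div m \<and> i mod m = j mod m" by (metis div_mult_mod_eq)
  then show "kron (1\<^sub>m n) (1\<^sub>m m) $$ (i,j) = (1\<^sub>m (n * m) :: 'a mat) $$ (i,j)"
    using ij dm index_kron[of "1\<^sub>m n" n n "1\<^sub>m m" m m i j] by auto
qed (auto simp: kron_def)

lemma kron_zero_right: "A \<in> carrier_mat n m \<Longrightarrow> kron A (0\<^sub>m n' m') = (0\<^sub>m (n * n') (m * m') :: 'a::semiring_1 mat)"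
  by (rule eq_matI) (auto simp: kron_def div_mod_less_mult)

lemma kron_minus_left:
  fixes A :: "'a::ring_1 mat"
  assumes "A \<in> carrier_mat n m" "A' \<in> carrier_mat n m" "B \<in> carrier_mat n' m'"
  shows "kron (A - A') B = kron A B - kron A' B"
  using assms by (intro eq_matI) (auto simp: kron_def left_diff_distrib right_diff_distrib div_mod_less_mult)

lemma kron_minus_right:
  fixes A :: "'a::ring_1 mat"
  assumes "A \<in> carrier_mat n m" "B \<in> carrier_mat n' m'" "B' \<in> carrier_mat n' m'"
  shows "kron A (B - B') = kron A B - kron A B'"
  using assms by (intro eq_matI) (auto simp: kron_def left_diff_distrib right_diff_distrib div_mod_less_mult)

text \<open>By the mixed product rule, Kronecker products of rank factorizations are factorizations
  and Kronecker products of identity compressions are identity compressions; the former give the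
  upper bound and the latter the lower one.\<close>

lemma mrank_kron:
  fixes A B :: "'a::field mat"
  assumes A: "A \<in> carrier_mat n m" and B: "B \<in> carrier_mat n' m'"
  shows "mrank (kron A B) = mrank A * mrank B"
proof (rule antisym)
  let ?r = "mrank A" and ?s = "mrank B"
  obtain P Q where PQ: "P \<in> carrier_mat n ?r" "Q \<in> carrier_mat ?r m" "A = P * Q"
    using mrank_factorization[OF A] by blast
  obtain P' Q' where PQ': "P' \<in> carrier_mat n' ?s" "Q' \<in> carrier_mat ?s m'" "B = P' * Q'"
    using mrank_factorization[OF B] by blast
  have "kron A B = kron P P' * kron Q Q'"
    using kron_mult[OF PQ(1) PQ'(1) PQ(2) PQ'(2)] by (simp add: PQ(3)[symmetric] PQ'(3)[symmetric])
  then show "mrank (kron A B) \<le> ?r * ?s"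
    using mrank_mult_le_inner[OF kron_carrier[OF PQ(1) PQ'(1)] kron_carrier[OF PQ(2) PQ'(2)]] by simp
  obtain X Y where XY: "X \<in> carrier_mat ?r n" "Y \<in> carrier_mat m ?r" "X * (A * Y) = 1\<^sub>m ?r"
    using mrank_compression[OF A] by blast
  obtain X' Y' where XY': "X' \<in> carrier_mat ?s n'" "Y' \<in> carrier_mat m' ?s" "X' * (B * Y') = 1\<^sub>m ?s"
    using mrank_compression[OF B] by blast
  have "kron X X' * kron A B * kron Y Y' = kron (X * A) (X' * B) * kron Y Y'"
    using kron_mult[OF XY(1) XY'(1) A B] by simp
  also have "\<dots> = kron (X * A * Y) (X' * B * Y')"
    using XY XY' A B by (intro kron_mult) auto
  also have "\<dots> = kron (1\<^sub>m ?r) (1\<^sub>m ?s)"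
    using XY XY' A B assoc_mult_mat[OF XY(1) A XY(2)] assoc_mult_mat[OF XY'(1) B XY'(2)] by simp
  finally show "?r * ?s \<le> mrank (kron A B)"
    using mrank_ge_of_identity[OF kron_carrier[OF XY(1) XY'(1)] kron_carrier[OF A B] kron_carrier[OF XY(2) XY'(2)]]
    by (simp add: kron_one)
qed

section \<open>Annihilators and the rank of a \<otimes> b - 1\<close>

text \<open>E = A Y X fixes the columns of \<open>A\<close> and has rank at most that of
  \<open>A\<close>. So 1 - E kills \<open>A\<close>, and by subadditivity its rank is large
  enough.\<close>

lemma left_annihilator:
  fixes A :: "'a::field mat"
  assumes A: "A \<in> carrier_mat n m"
  obtains L where "L \<in> carrier_mat n n" "L * A = 0\<^sub>m n m" "n \<le> mrank L + mrank A"
proof -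
  obtain X Y where XY: "X \<in> carrier_mat (mrank A) n" "Y \<in> carrier_mat m (mrank A)"
    "A = (A * Y) * (X * A)"
    using mrank_compression[OF A] by blast
  define E where "E = A * Y * X"
  have E: "E \<in> carrier_mat n n" using A XY by (auto simp: E_def)
  have "mrank E \<le> mrank A"
    unfolding E_def using A XY by (intro mrank_mult_le_inner[of _ n]) auto
  moreover have "1\<^sub>m n = (1\<^sub>m n - E) + E" using E by auto
  then have "n \<le> mrank (1\<^sub>m n - E) + mrank E"
    using mrank_add_le[of "1\<^sub>m n - E" n n E] E by (metis minus_carrier_mat mrank_one)
  moreover have "E * A = A"
    unfolding E_def using XY(3) assoc_mult_mat[of "A * Y" n "mrank A" X n A m] A XY(1,2) by simp
  then have "(1\<^sub>m n - E) * A = 0\<^sub>m n m"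
    using minus_mult_distrib_mat[OF one_carrier_mat E A] A by simp
  ultimately show ?thesis using that[of "1\<^sub>m n - E"] minus_carrier_mat[OF E] by auto
qed

text \<open>The mirror image, with E = Y X A and A E = A: the columns of 1 - E lie in the kernel of
  \<open>A\<close>.\<close>

lemma right_annihilator:
  fixes A :: "'a::field mat"
  assumes A: "A \<in> carrier_mat n m"
  obtains K where "K \<in> carrier_mat m m" "A * K = 0\<^sub>m n m" "m \<le> mrank K + mrank A"
proof -
  obtain X Y where XY: "X \<in> carrier_mat (mrank A) n" "Y \<in> carrier_mat m (mrank A)"
    "A = (A * Y) * (X * A)"
    using mrank_compression[OF A] by blast
  define E where "E = Y * (X * A)"
  have E: "E \<in> carrier_mat m m" using A XY unfolding E_def by (intro mult_carrier_mat)
  have "mrank E \<le> mrank A"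
    unfolding E_def using A XY by (intro mrank_mult_le_inner[of _ m]) auto
  moreover have "1\<^sub>m m = (1\<^sub>m m - E) + E" using E by auto
  then have "m \<le> mrank (1\<^sub>m m - E) + mrank E"
    using mrank_add_le[of "1\<^sub>m m - E" m m E] E by (metis minus_carrier_mat mrank_one)
  moreover have "A * E = A"
    unfolding E_def using XY(3) assoc_mult_mat[of A n m Y "mrank A" "X * A" m] A XY(1,2) by simp
  then have "A * (1\<^sub>m m - E) = 0\<^sub>m n m"
    using mult_minus_distrib_mat[OF A one_carrier_mat E] A by simp
  ultimately show ?thesis using that[of "1\<^sub>m m - E"] minus_carrier_mat[OF E] by auto
qed

lemma mrank_kron_minus_one_ge:
  fixes a b :: "'a::field mat"
  assumes a: "a \<in> carrier_mat n n" and b: "b \<in> carrier_mat m m"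
  shows "mrank (a - 1\<^sub>m n) * (m - mrank (b - 1\<^sub>m m)) + (n - mrank (a - 1\<^sub>m n)) * mrank (b - 1\<^sub>m m)
    \<le> mrank (kron a b - 1\<^sub>m (n * m))"
proof -
  \<comment> \<open>Write T for the map a \<otimes> b - 1. On ker (a - 1) \<otimes> W it acts as 1 \<otimes> (b - 1), with values in
    V \<otimes> im (b - 1), and modulo V \<otimes> im (b - 1) it acts as (a - 1) \<otimes> 1. The Frobenius inequality
    adds up the two ranks.\<close>
  define A where "A = a - 1\<^sub>m n"
  define B where "B = b - 1\<^sub>m m"
  define T where "T = kron a b - 1\<^sub>m (n * m)"
  have A: "A \<in> carrier_mat n n" and B: "B \<in> carrier_mat m m" and T: "T \<in> carrier_mat (n * m) (n * m)"
    using a b by (auto simp: A_def B_def T_def minus_carrier_mat)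
  \<comment> \<open>By the rank bounds, \<open>L\<close> is the quotient map modulo the image of
    \<open>B\<close>, up to an injective map, and the image of \<open>K\<close> is the whole kernel
    of \<open>A\<close>. On the right of \<open>T\<close>, \<open>kron K 1\<close> restricts to ker
    (a - 1) \<otimes> W; on the left, \<open>kron 1 L\<close> passes to the quotient by V \<otimes>
    im (b - 1).\<close>
  obtain L where L: "L \<in> carrier_mat m m" "L * B = 0\<^sub>m m m" "m \<le> mrank L + mrank B"
    using left_annihilator[OF B] by blast
  obtain K where K: "K \<in> carrier_mat n n" "A * K = 0\<^sub>m n n" "n \<le> mrank K + mrank A"
    using right_annihilator[OF A] by blast
  have I: "(1\<^sub>m k :: 'a mat) \<in> carrier_mat k k" for k by simp
  have "b = B + 1\<^sub>m m" unfolding B_def using b by auto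
  then have Lb: "L * b = L" using mult_add_distrib_mat[OF L(1) B I] L by simp
  have "a = A + 1\<^sub>m n" unfolding A_def using a by auto
  then have aK: "a * K = K" using add_mult_distrib_mat[OF A I K(1)] K by simp
  have XT: "kron (1\<^sub>m n) L * T = kron A L"
  proof -
    have "kron (1\<^sub>m n) L * T = kron (1\<^sub>m n) L * kron a b - kron (1\<^sub>m n) L * 1\<^sub>m (n * m)"
      unfolding T_def by (intro mult_minus_distrib_mat[OF kron_carrier[OF I L(1)] kron_carrier[OF a b] one_carrier_mat])
    also have "kron (1\<^sub>m n) L * kron a b = kron a L" using kron_mult[OF I L(1) a b] Lb a by simp
    also have "kron (1\<^sub>m n) L * 1\<^sub>m (n * m) = kron (1\<^sub>m n) L"
      using right_mult_one_mat[OF kron_carrier[OF I L(1)]] by simp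
    also have "kron a L - kron (1\<^sub>m n) L = kron A L"
      unfolding A_def using kron_minus_left[OF a I L(1)] by simp
    finally show ?thesis .
  qed
  have TY: "T * kron K (1\<^sub>m m) = kron K B"
  proof -
    have "T * kron K (1\<^sub>m m) = kron a b * kron K (1\<^sub>m m) - 1\<^sub>m (n * m) * kron K (1\<^sub>m m)"
      unfolding T_def by (intro minus_mult_distrib_mat[OF kron_carrier[OF a b] one_carrier_mat kron_carrier[OF K(1) I]])
    also have "kron a b * kron K (1\<^sub>m m) = kron K b" using kron_mult[OF a b K(1) I] aK b by simp
    also have "1\<^sub>m (n * m) * kron K (1\<^sub>m m) = kron K (1\<^sub>m m)"
      using left_mult_one_mat[OF kron_carrier[OF K(1) I]] by simp
    also have "kron K b - kron K (1\<^sub>m m) = kron K B"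
      unfolding B_def using kron_minus_right[OF K(1) b I] by simp
    finally show ?thesis .
  qed
  have "kron (1\<^sub>m n) L * (T * kron K (1\<^sub>m m)) = 0\<^sub>m (n * m) (n * m)"
    unfolding TY using kron_mult[OF I L(1) K(1) B] L K kron_zero_right[OF K(1), of m m] by simp
  from mrank_Frobenius[OF kron_carrier[OF I L(1)] T kron_carrier[OF K(1) I] this]
  have "mrank A * mrank L + mrank K * mrank B \<le> mrank T"
    unfolding XT TY mrank_kron[OF A L(1)] mrank_kron[OF K(1) B] .
  moreover have "mrank A * (m - mrank B) \<le> mrank A * mrank L" using L(3) by (intro mult_le_mono) auto
  moreover have "(n - mrank A) * mrank B \<le> mrank K * mrank B" using K(3) by (intro mult_le_mono) auto
  ultimately show ?thesis unfolding A_def B_def T_def by linarith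
qed

lemma diff_add_diff_mat:
  "A \<in> carrier_mat n m \<Longrightarrow> B \<in> carrier_mat n m \<Longrightarrow> C \<in> carrier_mat n m \<Longrightarrow> (A - B) + (B - C) = (A - C :: 'a::ring_1 mat)"
  by (rule eq_matI) auto

lemma diff_self_mat: "A \<in> carrier_mat n m \<Longrightarrow> A - A = (0\<^sub>m n m :: 'a::ring_1 mat)"
  by (rule eq_matI) auto

subsection \<open>Normalized rank\<close>

lemma rho_eq: "a \<in> carrier_mat n n \<Longrightarrow> rho n a = real (mrank a) / real n"
  by (simp add: rho_def mrank_def)

lemma rho_nonneg: "0 \<le> rho n a" by (simp add: rho_def)

lemma rho_le_one: "a \<in> carrier_mat n n \<Longrightarrow> rho n a \<le> 1"
  using mrank_le_dim_row[of a n n] by (auto simp: rho_eq divide_le_eq_1)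

lemma rho_zero [simp]: "rho n (0\<^sub>m n n) = 0" by (simp add: rho_eq)

lemma rho_add_le:
  "a \<in> carrier_mat n n \<Longrightarrow> b \<in> carrier_mat n n \<Longrightarrow> rho n (a + b) \<le> rho n a + rho n b"
  using mrank_add_le[of a n n b] by (simp add: rho_eq divide_right_mono flip: add_divide_distrib of_nat_add)

lemma rho_uminus: "a \<in> carrier_mat n n \<Longrightarrow> rho n (- a) = rho n a"
  by (simp add: rho_eq mrank_uminus)

lemma rho_minus_commute:
  "a \<in> carrier_mat n n \<Longrightarrow> b \<in> carrier_mat n n \<Longrightarrow> rho n (a - b) = rho n (b - a)"
proof -
  assume *: "a \<in> carrier_mat n n" "b \<in> carrier_mat n n"
  then have "a - b = - (b - a)" by (intro eq_matI) auto
  with * show ?thesis by (simp add: rho_uminus minus_carrier_mat)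
qed

lemma rho_diff_triangle:
  assumes "a \<in> carrier_mat n n" "b \<in> carrier_mat n n" "c \<in> carrier_mat n n"
  shows "rho n (a - c) \<le> rho n (a - b) + rho n (b - c)"
  using rho_add_le[of "a - b" n "b - c"] assms diff_add_diff_mat[OF assms] by (simp add: minus_carrier_mat)

lemma rho_mult_le_left:
  "a \<in> carrier_mat n n \<Longrightarrow> b \<in> carrier_mat n n \<Longrightarrow> rho n (a * b) \<le> rho n a"
  using mrank_mult_le_left[of a n n b n] by (simp add: rho_eq divide_right_mono)

lemma rho_mult_le_right:
  "a \<in> carrier_mat n n \<Longrightarrow> b \<in> carrier_mat n n \<Longrightarrow> rho n (a * b) \<le> rho n b"
  using mrank_mult_le_right[of a n n b n] by (simp add: rho_eq divide_right_mono)

lemma rho_kron: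
  assumes "a \<in> carrier_mat n n" "b \<in> carrier_mat m m"
  shows "rho (n * m) (kron a b) = rho n a * rho m b"
  using assms by (simp add: rho_eq[OF kron_carrier] rho_eq mrank_kron)

text \<open>Insert \<open>kron c b\<close> and use that \<open>rho\<close> is multiplicative on
  Kronecker products and at most 1. For a = b and c = d the error at most doubles, which is the
  price of one tensor squaring.\<close>

lemma rho_kron_diff_le:
  assumes a: "a \<in> carrier_mat n n" and c: "c \<in> carrier_mat n n"
    and b: "b \<in> carrier_mat m m" and d: "d \<in> carrier_mat m m"
  shows "rho (n * m) (kron a b - kron c d) \<le> rho n (a - c) + rho m (b - d)"
proof -
  have "rho (n * m) (kron a b - kron c d)
    \<le> rho (n * m) (kron a b - kron c b) + rho (n * m) (kron c b - kron c d)"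
    using assms by (intro rho_diff_triangle kron_carrier)
  also have "\<dots> = rho n (a - c) * rho m b + rho n c * rho m (b - d)"
    using assms by (simp add: kron_minus_left[symmetric] kron_minus_right[symmetric] rho_kron minus_carrier_mat)
  also have "\<dots> \<le> rho n (a - c) * 1 + 1 * rho m (b - d)"
    using assms by (intro add_mono mult_mono rho_le_one rho_nonneg order_refl) auto
  finally show ?thesis by simp
qed

lemma rho_kron_self_minus_one_ge:
  assumes a: "a \<in> carrier_mat n n" and n: "n > 0"
  shows "2 * rho n (a - 1\<^sub>m n) * (1 - rho n (a - 1\<^sub>m n)) \<le> rho (n * n) (kron a a - 1\<^sub>m (n * n))"
proof -
  define r where "r = mrank (a - 1\<^sub>m n)"
  define R where "R = mrank (kron a a - 1\<^sub>m (n * n))"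
  have r: "r \<le> n" unfolding r_def by (rule mrank_le_dim_row[of _ n n]) (simp add: minus_carrier_mat)
  have "r * (n - r) + (n - r) * r \<le> R"
    using mrank_kron_minus_one_ge[OF a a] by (simp add: r_def R_def)
  then have "real (r * (n - r) + (n - r) * r) \<le> real R" by (rule of_nat_mono)
  moreover have "real (n - r) = real n - real r" using r by (rule of_nat_diff)
  ultimately have "2 * real r * (real n - real r) \<le> real R" by simp
  then have "2 * real r * (real n - real r) / real (n * n) \<le> real R / real (n * n)"
    by (rule divide_right_mono) simp
  moreover have "2 * real r * (real n - real r) / real (n * n) = 2 * (real r / real n) * (1 - real r / real n)"
    using n by (simp add: field_simps)
  moreover have "rho n (a - 1\<^sub>m n) = real r / real n"
    by (simp add: rho_eq minus_carrier_mat r_def)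
  moreover have "rho (n * n) (kron a a - 1\<^sub>m (n * n)) = real R / real (n * n)"
    by (simp add: rho_eq minus_carrier_mat R_def)
  ultimately show ?thesis by simp
qed

subsection \<open>Mixing two matrices\<close>

text \<open>Same scheme as for Kronecker products: block sums of factorizations bound the rank from
  above, block sums of identity compressions from below.\<close>

lemma mrank_four_block_diag:
  fixes A B :: "'a::field mat"
  assumes A: "A \<in> carrier_mat n m" and B: "B \<in> carrier_mat n' m'"
  shows "mrank (four_block_mat A (0\<^sub>m n m') (0\<^sub>m n' m) B) = mrank A + mrank B"
proof (rule antisym)
  let ?r = "mrank A" and ?s = "mrank B" and ?D = "four_block_mat A (0\<^sub>m n m') (0\<^sub>m n' m) B"
  obtain P Q where PQ: "P \<in> carrier_mat n ?r" "Q \<in> carrier_mat ?r m" "A = P * Q"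
    using mrank_factorization[OF A] by blast
  obtain P' Q' where PQ': "P' \<in> carrier_mat n' ?s" "Q' \<in> carrier_mat ?s m'" "B = P' * Q'"
    using mrank_factorization[OF B] by blast
  have "four_block_mat P (0\<^sub>m n ?s) (0\<^sub>m n' ?r) P' * four_block_mat Q (0\<^sub>m ?r m') (0\<^sub>m ?s m) Q'
    = four_block_mat (P * Q) (0\<^sub>m n m') (0\<^sub>m n' m) (P' * Q')"
    using PQ(1,2) PQ'(1,2)
    by (subst mult_four_block_mat[OF PQ(1) _ _ PQ'(1) PQ(2) _ _ PQ'(2)]) (auto intro!: cong_four_block_mat)
  then have "?D = four_block_mat P (0\<^sub>m n ?s) (0\<^sub>m n' ?r) P' * four_block_mat Q (0\<^sub>m ?r m') (0\<^sub>m ?s m) Q'"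
    by (simp add: PQ(3)[symmetric] PQ'(3)[symmetric])
  then show "mrank ?D \<le> ?r + ?s"
    using mrank_mult_le_inner[OF four_block_carrier_mat[OF PQ(1) PQ'(1)] four_block_carrier_mat[OF PQ(2) PQ'(2)]] by simp
  obtain X Y where XY: "X \<in> carrier_mat ?r n" "Y \<in> carrier_mat m ?r" "X * (A * Y) = 1\<^sub>m ?r"
    using mrank_compression[OF A] by blast
  obtain X' Y' where XY': "X' \<in> carrier_mat ?s n'" "Y' \<in> carrier_mat m' ?s" "X' * (B * Y') = 1\<^sub>m ?s"
    using mrank_compression[OF B] by blast
  let ?X = "four_block_mat X (0\<^sub>m ?r n') (0\<^sub>m ?s n) X'" and ?Y = "four_block_mat Y (0\<^sub>m m ?s) (0\<^sub>m m' ?r) Y'"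
  have "?D * ?Y = four_block_mat (A * Y) (0\<^sub>m n ?s) (0\<^sub>m n' ?r) (B * Y')"
    using XY(1,2) XY'(1,2) A B
    by (subst mult_four_block_mat[OF A _ _ B XY(2) _ _ XY'(2)]) (auto intro!: cong_four_block_mat)
  then have "?X * (?D * ?Y) = ?X * four_block_mat (A * Y) (0\<^sub>m n ?s) (0\<^sub>m n' ?r) (B * Y')" by simp
  also have "\<dots> = four_block_mat (X * (A * Y)) (0\<^sub>m ?r ?s) (0\<^sub>m ?s ?r) (X' * (B * Y'))"
    using XY(1,2) XY'(1,2) A B
    by (subst mult_four_block_mat[OF XY(1) _ _ XY'(1) mult_carrier_mat[OF A XY(2)] _ _ mult_carrier_mat[OF B XY'(2)]])
       (auto intro!: cong_four_block_mat)
  also have "\<dots> = 1\<^sub>m (?r + ?s)" by (simp add: XY(3) XY'(3))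
  finally have *: "?X * (?D * ?Y) = 1\<^sub>m (?r + ?s)" .
  have car: "?X \<in> carrier_mat (?r + ?s) (n + n')" "?D \<in> carrier_mat (n + n') (m + m')"
    "?Y \<in> carrier_mat (m + m') (?r + ?s)"
    using four_block_carrier_mat[OF XY(1) XY'(1)] four_block_carrier_mat[OF XY(2) XY'(2)]
      four_block_carrier_mat[OF A B] by blast+
  from * have "?X * ?D * ?Y = 1\<^sub>m (?r + ?s)" using assoc_mult_mat[OF car] by simp
  then show "?r + ?s \<le> mrank ?D" using mrank_ge_of_identity[OF car] by blast
qed

text \<open>A plain block sum would weigh the two normalized ranks by the sizes n and m. Tensoring
  with identities first brings both blocks to size n m, so that each counts exactly one half,
  whatever n and m are.\<close>

definition mix_mat :: "nat \<Rightarrow> nat \<Rightarrow> 'a::field mat \<Rightarrow> 'a mat \<Rightarrow> 'a mat" where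
  "mix_mat n m a b = four_block_mat (kron a (1\<^sub>m m)) (0\<^sub>m (n * m) (n * m)) (0\<^sub>m (n * m) (n * m)) (kron (1\<^sub>m n) b)"

lemma mix_mat_carrier:
  "a \<in> carrier_mat n n \<Longrightarrow> b \<in> carrier_mat m m \<Longrightarrow> mix_mat n m a b \<in> carrier_mat (n * m + n * m) (n * m + n * m)"
  unfolding mix_mat_def by (intro four_block_carrier_mat kron_carrier) auto

lemma mix_mat_mult:
  assumes a: "a \<in> carrier_mat n n" and b: "b \<in> carrier_mat m m"
    and c: "c \<in> carrier_mat n n" and d: "d \<in> carrier_mat m m"
  shows "mix_mat n m a b * mix_mat n m c d = mix_mat n m (a * c) (b * d)"
proof -
  have car: "kron a (1\<^sub>m m) \<in> carrier_mat (n * m) (n * m)" "kron c (1\<^sub>m m) \<in> carrier_mat (n * m) (n * m)"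
    "kron (1\<^sub>m n) b \<in> carrier_mat (n * m) (n * m)" "kron (1\<^sub>m n) d \<in> carrier_mat (n * m) (n * m)"
    "kron (a * c) (1\<^sub>m m) \<in> carrier_mat (n * m) (n * m)" "kron (1\<^sub>m n) (b * d) \<in> carrier_mat (n * m) (n * m)"
    using assms by auto
  show ?thesis unfolding mix_mat_def
    using car kron_mult[OF a one_carrier_mat c one_carrier_mat, of m] kron_mult[OF one_carrier_mat b one_carrier_mat d, of n]
    by (subst mult_four_block_mat[OF car(1) _ _ car(3) car(2) _ _ car(4)]) (auto intro!: cong_four_block_mat)
qed

lemma mix_mat_one: "mix_mat n m (1\<^sub>m n) (1\<^sub>m m) = 1\<^sub>m (n * m + n * m)"
  by (simp add: mix_mat_def kron_one)

lemma mix_mat_diff: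
  assumes a: "a \<in> carrier_mat n n" and b: "b \<in> carrier_mat m m"
    and c: "c \<in> carrier_mat n n" and d: "d \<in> carrier_mat m m"
  shows "mix_mat n m a b - mix_mat n m c d = mix_mat n m (a - c) (b - d)"
proof -
  have car: "kron a (1\<^sub>m m) \<in> carrier_mat (n * m) (n * m)" "kron c (1\<^sub>m m) \<in> carrier_mat (n * m) (n * m)"
    "kron (1\<^sub>m n) b \<in> carrier_mat (n * m) (n * m)" "kron (1\<^sub>m n) d \<in> carrier_mat (n * m) (n * m)"
    using assms by auto
  show ?thesis unfolding mix_mat_def kron_minus_left[OF a c one_carrier_mat] kron_minus_right[OF one_carrier_mat b d]
    using car by (intro eq_matI) auto
qed

lemma rho_mix_mat:
  assumes a: "a \<in> carrier_mat n n" and b: "b \<in> carrier_mat m m" and "n > 0" "m > 0"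
  shows "rho (n * m + n * m) (mix_mat n m a b) = (rho n a + rho m b) / 2"
proof -
  have "mrank (mix_mat n m a b) = mrank a * m + n * mrank b"
    unfolding mix_mat_def
    using mrank_four_block_diag[OF kron_carrier[OF a one_carrier_mat[of m]] kron_carrier[OF one_carrier_mat[of n] b]]
      mrank_kron[OF a one_carrier_mat[of m]] mrank_kron[OF one_carrier_mat[of n] b] by simp
  then show ?thesis using rho_eq[OF mix_mat_carrier[OF a b]] a b \<open>n > 0\<close> \<open>m > 0\<close>
    by (simp add: rho_eq field_simps)
qed

subsection \<open>Almost representations\<close>

definition GL_mat :: "nat \<Rightarrow> complex mat set" where
  "GL_mat n = {a \<in> carrier_mat n n. invertible_mat a}"

lemma GL_mat_carrier: "a \<in> GL_mat n \<Longrightarrow> a \<in> carrier_mat n n"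
  by (simp add: GL_mat_def)

lemma GL_mat_iff:
  "a \<in> GL_mat n \<longleftrightarrow> a \<in> carrier_mat n n \<and> (\<exists>b \<in> carrier_mat n n. a * b = 1\<^sub>m n \<and> b * a = 1\<^sub>m n)"
proof safe
  assume "a \<in> GL_mat n"
  then have a: "a \<in> carrier_mat n n" and "invertible_mat a" by (auto simp: GL_mat_def)
  then obtain b where b: "a * b = 1\<^sub>m n" "b * a = 1\<^sub>m (dim_row b)"
    by (auto simp: invertible_mat_def inverts_mat_def)
  \<comment> \<open>The definition of invertibility does not fix the shape of \<open>b\<close>; it
    follows by comparing the dimensions of the two products with those of the identities.\<close>
  have "dim_col (a * b) = n" "dim_col (b * a) = dim_row b" using b by auto
  then have "b \<in> carrier_mat n n" using a by auto
  then show "\<exists>b \<in> carrier_mat n n. a * b = 1\<^sub>m n \<and> b * a = 1\<^sub>m n" using b by auto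
  show "a \<in> carrier_mat n n" by (rule a)
next
  fix b assume "a \<in> carrier_mat n n" "b \<in> carrier_mat n n" "a * b = 1\<^sub>m n" "b * a = 1\<^sub>m n"
  then show "a \<in> GL_mat n" by (auto simp: GL_mat_def invertible_mat_def inverts_mat_def)
qed

lemma GL_matI:
  "a \<in> carrier_mat n n \<Longrightarrow> b \<in> carrier_mat n n \<Longrightarrow> a * b = 1\<^sub>m n \<Longrightarrow> b * a = 1\<^sub>m n \<Longrightarrow> a \<in> GL_mat n"
  using GL_mat_iff by blast

lemma GL_mat_inverse:
  assumes "a \<in> GL_mat n"
  obtains b where "b \<in> GL_mat n" "a * b = 1\<^sub>m n" "b * a = 1\<^sub>m n"
  using assms GL_mat_iff by metis

lemma GL_mat_one: "1\<^sub>m n \<in> GL_mat n"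
  by (rule GL_matI[of _ _ "1\<^sub>m n"]) auto

lemma GL_mat_mult:
  assumes "a \<in> GL_mat n" "b \<in> GL_mat n"
  shows "a * b \<in> GL_mat n"
proof -
  obtain a' where a': "a' \<in> GL_mat n" "a * a' = 1\<^sub>m n" "a' * a = 1\<^sub>m n" using GL_mat_inverse assms(1) by blast
  obtain b' where b': "b' \<in> GL_mat n" "b * b' = 1\<^sub>m n" "b' * b = 1\<^sub>m n" using GL_mat_inverse assms(2) by blast
  have cancel: "(x * y) * (y' * x') = 1\<^sub>m n"
    if c: "x \<in> carrier_mat n n" "y \<in> carrier_mat n n" "y' \<in> carrier_mat n n" "x' \<in> carrier_mat n n"
      and "x * x' = 1\<^sub>m n" "y * y' = 1\<^sub>m n" for x y x' y' :: "complex mat"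
  proof -
    have "(x * y) * (y' * x') = x * (y * (y' * x'))"
      by (rule assoc_mult_mat[OF c(1,2) mult_carrier_mat[OF c(3,4)]])
    also have "y * (y' * x') = y * y' * x'" by (rule assoc_mult_mat[OF c(2,3,4), symmetric])
    finally show ?thesis using that by simp
  qed
  show ?thesis using assms a' b'
    by (intro GL_matI[of _ _ "b' * a'"] cancel mult_carrier_mat[of _ n n]) (auto dest: GL_mat_carrier)
qed

lemma GL_mat_kron:
  assumes "a \<in> GL_mat n" "b \<in> GL_mat m"
  shows "kron a b \<in> GL_mat (n * m)"
proof -
  obtain a' where a': "a' \<in> GL_mat n" "a * a' = 1\<^sub>m n" "a' * a = 1\<^sub>m n" using GL_mat_inverse assms(1) by blast
  obtain b' where b': "b' \<in> GL_mat m" "b * b' = 1\<^sub>m m" "b' * b = 1\<^sub>m m" using GL_mat_inverse assms(2) by blast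
  note c = GL_mat_carrier[OF assms(1)] GL_mat_carrier[OF assms(2)] GL_mat_carrier[OF a'(1)] GL_mat_carrier[OF b'(1)]
  show ?thesis
    by (rule GL_matI[of _ _ "kron a' b'"])
       (use c a' b' in \<open>auto simp: kron_mult[OF c(1,2,3,4)] kron_mult[OF c(3,4,1,2)] kron_one\<close>)
qed

lemma GL_mat_mix:
  assumes "a \<in> GL_mat n" "b \<in> GL_mat m"
  shows "mix_mat n m a b \<in> GL_mat (n * m + n * m)"
proof -
  obtain a' where a': "a' \<in> GL_mat n" "a * a' = 1\<^sub>m n" "a' * a = 1\<^sub>m n" using GL_mat_inverse assms(1) by blast
  obtain b' where b': "b' \<in> GL_mat m" "b * b' = 1\<^sub>m m" "b' * b = 1\<^sub>m m" using GL_mat_inverse assms(2) by blast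
  note c = GL_mat_carrier[OF assms(1)] GL_mat_carrier[OF assms(2)] GL_mat_carrier[OF a'(1)] GL_mat_carrier[OF b'(1)]
  show ?thesis
    by (rule GL_matI[of _ _ "mix_mat n m a' b'"])
       (use c a' b' in \<open>auto simp: mix_mat_mult[OF c(1,2,3,4)] mix_mat_mult[OF c(3,4,1,2)] mix_mat_one mix_mat_carrier\<close>)
qed

text \<open>Products of elements of \<open>F\<close> may leave \<open>F\<close>, so values are
  required to be invertible on the whole carrier while the defect is controlled on \<open>F\<close>
  only. There is no clause for the unit: in the ultraproduct the limiting map is a group
  homomorphism and sends it to the unit by itself.\<close>

definition almost_rep ::
  "('a, 'b) monoid_scheme \<Rightarrow> 'a set \<Rightarrow> real \<Rightarrow> nat \<Rightarrow> ('a \<Rightarrow> complex mat) \<Rightarrow> bool" where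
  "almost_rep G F \<epsilon> n \<phi> \<longleftrightarrow> n > 0 \<and> (\<forall>x \<in> carrier G. \<phi> x \<in> GL_mat n) \<and>
     (\<forall>x \<in> F. \<forall>y \<in> F. rho n (\<phi> x * \<phi> y - \<phi> (x \<otimes>\<^bsub>G\<^esub> y)) \<le> \<epsilon>)"

lemma almost_rep_mono: "almost_rep G F \<epsilon> n \<phi> \<Longrightarrow> \<epsilon> \<le> \<epsilon>' \<Longrightarrow> almost_rep G F \<epsilon>' n \<phi>"
  by (fastforce simp: almost_rep_def)

text \<open>Starts the mixing induction in an arbitrarily large dimension, and stands in when no
  separation is asked for.\<close>

lemma almost_rep_trivial:
  assumes "n > 0" "\<epsilon> \<ge> 0"
  shows "almost_rep G F \<epsilon> n (\<lambda>_. 1\<^sub>m n)"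
proof -
  have zero: "1\<^sub>m n * 1\<^sub>m n - 1\<^sub>m n = (0\<^sub>m n n :: complex mat)"
    unfolding right_mult_one_mat[OF one_carrier_mat] by (rule diff_self_mat) simp
  show ?thesis unfolding almost_rep_def zero using assms by (simp add: GL_mat_one)
qed

lemma almost_rep_square:
  assumes G: "monoid G" and F: "F \<subseteq> carrier G" and \<phi>: "almost_rep G F \<epsilon> n \<phi>"
  shows "almost_rep G F (2 * \<epsilon>) (n * n) (\<lambda>x. kron (\<phi> x) (\<phi> x))"
  unfolding almost_rep_def
proof (intro conjI ballI)
  show "0 < n * n" using \<phi> by (simp add: almost_rep_def)
  show "kron (\<phi> x) (\<phi> x) \<in> GL_mat (n * n)" if "x \<in> carrier G" for x
    using that \<phi> by (simp add: almost_rep_def GL_mat_kron)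
  fix x y assume xy: "x \<in> F" "y \<in> F"
  then have "x \<in> carrier G" "y \<in> carrier G" "x \<otimes>\<^bsub>G\<^esub> y \<in> carrier G" using F G by (auto intro: monoid.m_closed)
  then have c: "\<phi> x \<in> carrier_mat n n" "\<phi> y \<in> carrier_mat n n" "\<phi> (x \<otimes>\<^bsub>G\<^esub> y) \<in> carrier_mat n n"
    using \<phi> by (auto simp: almost_rep_def GL_mat_carrier)
  note d = mult_carrier_mat[OF c(1,2)]
  have "rho n (\<phi> x * \<phi> y - \<phi> (x \<otimes>\<^bsub>G\<^esub> y)) \<le> \<epsilon>" using \<phi> xy by (simp add: almost_rep_def)
  then show "rho (n * n) (kron (\<phi> x) (\<phi> x) * kron (\<phi> y) (\<phi> y) - kron (\<phi> (x \<otimes>\<^bsub>G\<^esub> y)) (\<phi> (x \<otimes>\<^bsub>G\<^esub> y))) \<le> 2 * \<epsilon>"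
    unfolding kron_mult[OF c(1,1,2,2)] using rho_kron_diff_le[OF d c(3) d c(3)] by simp
qed

text \<open>The defect of a mixture is the average of the two defects. In contrast to tensor
  squaring, mixing can thus be iterated without any loss in \<epsilon>.\<close>

lemma almost_rep_mix:
  assumes G: "monoid G" and F: "F \<subseteq> carrier G" and \<phi>: "almost_rep G F \<epsilon> n \<phi>" and \<psi>: "almost_rep G F \<epsilon> m \<psi>"
  shows "almost_rep G F \<epsilon> (n * m + n * m) (\<lambda>x. mix_mat n m (\<phi> x) (\<psi> x))"
  unfolding almost_rep_def
proof (intro conjI ballI)
  have nm: "n > 0" "m > 0" using \<phi> \<psi> by (auto simp: almost_rep_def)
  then show "0 < n * m + n * m" by simp
  show "mix_mat n m (\<phi> x) (\<psi> x) \<in> GL_mat (n * m + n * m)" if "x \<in> carrier G" for x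
    using that \<phi> \<psi> by (simp add: almost_rep_def GL_mat_mix)
  fix x y assume xy: "x \<in> F" "y \<in> F"
  then have "x \<in> carrier G" "y \<in> carrier G" "x \<otimes>\<^bsub>G\<^esub> y \<in> carrier G" using F G by (auto intro: monoid.m_closed)
  then have c: "\<phi> x \<in> carrier_mat n n" "\<phi> y \<in> carrier_mat n n" "\<phi> (x \<otimes>\<^bsub>G\<^esub> y) \<in> carrier_mat n n"
    "\<psi> x \<in> carrier_mat m m" "\<psi> y \<in> carrier_mat m m" "\<psi> (x \<otimes>\<^bsub>G\<^esub> y) \<in> carrier_mat m m"
    using \<phi> \<psi> by (auto simp: almost_rep_def GL_mat_carrier)
  have "rho n (\<phi> x * \<phi> y - \<phi> (x \<otimes>\<^bsub>G\<^esub> y)) \<le> \<epsilon>" "rho m (\<psi> x * \<psi> y - \<psi> (x \<otimes>\<^bsub>G\<^esub> y)) \<le> \<epsilon>"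
    using \<phi> \<psi> xy by (simp_all add: almost_rep_def)
  moreover have "mix_mat n m (\<phi> x) (\<psi> x) * mix_mat n m (\<phi> y) (\<psi> y) - mix_mat n m (\<phi> (x \<otimes>\<^bsub>G\<^esub> y)) (\<psi> (x \<otimes>\<^bsub>G\<^esub> y))
     = mix_mat n m (\<phi> x * \<phi> y - \<phi> (x \<otimes>\<^bsub>G\<^esub> y)) (\<psi> x * \<psi> y - \<psi> (x \<otimes>\<^bsub>G\<^esub> y))"
    unfolding mix_mat_mult[OF c(1,4,2,5)]
    by (rule mix_mat_diff[OF mult_carrier_mat[OF c(1,2)] mult_carrier_mat[OF c(4,5)] c(3,6)])
  moreover have "rho (n * m + n * m) (mix_mat n m (\<phi> x * \<phi> y - \<phi> (x \<otimes>\<^bsub>G\<^esub> y)) (\<psi> x * \<psi> y - \<psi> (x \<otimes>\<^bsub>G\<^esub> y)))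
    = (rho n (\<phi> x * \<phi> y - \<phi> (x \<otimes>\<^bsub>G\<^esub> y)) + rho m (\<psi> x * \<psi> y - \<psi> (x \<otimes>\<^bsub>G\<^esub> y))) / 2"
    by (rule rho_mix_mat[OF minus_carrier_mat[OF c(3)] minus_carrier_mat[OF c(6)] nm])
  ultimately show "rho (n * m + n * m) (mix_mat n m (\<phi> x) (\<psi> x) * mix_mat n m (\<phi> y) (\<psi> y)
      - mix_mat n m (\<phi> (x \<otimes>\<^bsub>G\<^esub> y)) (\<psi> (x \<otimes>\<^bsub>G\<^esub> y))) \<le> \<epsilon>"
    by simp
qed

lemma rho_mix_mat_minus_one:
  assumes "a \<in> carrier_mat n n" "b \<in> carrier_mat m m" "n > 0" "m > 0"
  shows "rho (n * m + n * m) (mix_mat n m a b - 1\<^sub>m (n * m + n * m))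
    = (rho n (a - 1\<^sub>m n) + rho m (b - 1\<^sub>m m)) / 2"
  unfolding mix_mat_one[symmetric] mix_mat_diff[OF assms(1,2) one_carrier_mat one_carrier_mat]
  by (rule rho_mix_mat[OF minus_carrier_mat minus_carrier_mat assms(3,4)]) auto

section \<open>Amplification and simultaneous separation\<close>

text \<open>M bounds the number of squarings still available. One squaring lowers M by 1, multiplies
  the guaranteed distance by 3/2 and at most doubles the defect, so both the defect hypothesis and
  (3/2)^M \<delta> \<ge> 1/4 are preserved; at M = 0 the latter gives the claim.\<close>

lemma almost_rep_amplify:
  assumes G: "monoid G" and F: "F \<subseteq> carrier G" and g: "g \<in> carrier G" and \<epsilon>: "\<epsilon> \<ge> 0"
  shows "almost_rep G F (\<epsilon> / 2 ^ M) n \<phi> \<Longrightarrow> rho n (\<phi> g - 1\<^sub>m n) \<ge> \<delta> \<Longrightarrow> (3/2) ^ M * \<delta> \<ge> 1/4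
    \<Longrightarrow> \<exists>n \<phi>. almost_rep G F \<epsilon> n \<phi> \<and> rho n (\<phi> g - 1\<^sub>m n) \<ge> 1/4"
proof (induction M arbitrary: n \<phi> \<delta>)
  case 0
  then show ?case by (auto intro!: exI[of _ n] exI[of _ \<phi>])
next
  case (Suc M)
  let ?d = "rho n (\<phi> g - 1\<^sub>m n)"
  show ?case
  proof (cases "?d \<ge> 1/4")
    \<comment> \<open>The process stops early here, since a further squaring could bring the
      distance down again.\<close>
    case True
    have "1 \<le> (2::real) ^ Suc M" by (rule one_le_power) simp
    then have "\<epsilon> / 2 ^ Suc M \<le> \<epsilon>" using divide_left_mono[of 1 "2 ^ Suc M" \<epsilon>] \<epsilon> by simp
    then show ?thesis using almost_rep_mono[OF Suc.prems(1)] True by blast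
  next
    case False
    have n: "n > 0" and a: "\<phi> g \<in> carrier_mat n n" using Suc.prems(1) g by (auto simp: almost_rep_def GL_mat_carrier)
    have "(3/2) * \<delta> \<le> (3/2) * ?d" using Suc.prems(2) by simp
    \<comment> \<open>This is where d < 1/4 enters: it gives 2 (1 - d) \<ge> 3/2.\<close>
    also have "\<dots> \<le> 2 * (1 - ?d) * ?d"
      using False rho_nonneg[of n "\<phi> g - 1\<^sub>m n"] by (intro mult_right_mono) auto
    also have "\<dots> \<le> rho (n * n) (kron (\<phi> g) (\<phi> g) - 1\<^sub>m (n * n))"
      using rho_kron_self_minus_one_ge[OF a n] by (simp add: algebra_simps)
    finally have "(3/2) * \<delta> \<le> rho (n * n) (kron (\<phi> g) (\<phi> g) - 1\<^sub>m (n * n))" .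
    moreover have "almost_rep G F (\<epsilon> / 2 ^ M) (n * n) (\<lambda>x. kron (\<phi> x) (\<phi> x))"
      using almost_rep_square[OF G F Suc.prems(1)] by simp
    ultimately show ?thesis using Suc.IH[of "n * n" "\<lambda>x. kron (\<phi> x) (\<phi> x)" "(3/2) * \<delta>"] Suc.prems(3) by (simp add: mult_ac)
  qed
qed

text \<open>The bounds decrease geometrically because each further mixing step halves the distances
  obtained before.\<close>
definition separates :: "('a, 'b) monoid_scheme \<Rightarrow> 'a list \<Rightarrow> nat \<Rightarrow> ('a \<Rightarrow> complex mat) \<Rightarrow> bool" where
  "separates G xs n \<phi> \<longleftrightarrow>
     (\<forall>t < length xs. xs ! t \<noteq> \<one>\<^bsub>G\<^esub> \<longrightarrow> rho n (\<phi> (xs ! t) - 1\<^sub>m n) \<ge> 1 / (8 * 2 ^ t))"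

text \<open>Mix an almost representation for the head, at distance 1/4, with one for the tail.
  Averaging turns 1/4 into 1/8, the bound for position 0, and 1/(8 * 2^s) into 1/(8 * 2^(s+1)),
  which matches the shift of positions. The resulting bound depends on the position alone, not on G,
  F or \<epsilon>. The dimension 2 n m stays above N because that of the tail is.\<close>

lemma almost_rep_separates:
  assumes G: "monoid G" and F: "F \<subseteq> carrier G" and \<epsilon>: "\<epsilon> \<ge> 0"
    and single: "\<And>g. g \<in> carrier G \<Longrightarrow> g \<noteq> \<one>\<^bsub>G\<^esub> \<Longrightarrow>
      \<exists>n \<phi>. almost_rep G F \<epsilon> n \<phi> \<and> rho n (\<phi> g - 1\<^sub>m n) \<ge> 1/4"
  shows "set xs \<subseteq> carrier G \<Longrightarrow> \<exists>n \<phi>. n \<ge> N \<and> almost_rep G F \<epsilon> n \<phi> \<and> separates G xs n \<phi>"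
proof (induction xs)
  case Nil
  show ?case using almost_rep_trivial[of "Suc N" \<epsilon> G F] \<epsilon>
    by (intro exI[of _ "Suc N"] exI[of _ "\<lambda>_. 1\<^sub>m (Suc N)"]) (auto simp: separates_def)
next
  case (Cons g xs)
  then obtain m \<psi> where m: "m \<ge> N" and \<psi>: "almost_rep G F \<epsilon> m \<psi>" and sep: "separates G xs m \<psi>" by auto
  \<comment> \<open>If g is the unit nothing has to be separated, and the trivial representation of
    dimension 1 fills the slot.\<close>
  have "\<exists>n \<phi>. almost_rep G F \<epsilon> n \<phi> \<and> (g \<noteq> \<one>\<^bsub>G\<^esub> \<longrightarrow> rho n (\<phi> g - 1\<^sub>m n) \<ge> 1/4)"
    using single[of g] Cons.prems almost_rep_trivial[of 1 \<epsilon> G F] \<epsilon> by (cases "g = \<one>\<^bsub>G\<^esub>") auto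
  then obtain n \<phi> where \<phi>: "almost_rep G F \<epsilon> n \<phi>" and g: "g \<noteq> \<one>\<^bsub>G\<^esub> \<Longrightarrow> rho n (\<phi> g - 1\<^sub>m n) \<ge> 1/4" by blast
  have nm: "n > 0" "m > 0" using \<phi> \<psi> by (auto simp: almost_rep_def)
  have rho: "rho (n * m + n * m) (mix_mat n m (\<phi> x) (\<psi> x) - 1\<^sub>m (n * m + n * m))
     = (rho n (\<phi> x - 1\<^sub>m n) + rho m (\<psi> x - 1\<^sub>m m)) / 2" if "x \<in> carrier G" for x
    using that \<phi> \<psi> by (intro rho_mix_mat_minus_one nm) (auto simp: almost_rep_def GL_mat_carrier)
  have "separates G (g # xs) (n * m + n * m) (\<lambda>x. mix_mat n m (\<phi> x) (\<psi> x))"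
    unfolding separates_def
  proof (intro allI impI)
    fix t assume t: "t < length (g # xs)" "(g # xs) ! t \<noteq> \<one>\<^bsub>G\<^esub>"
    then have "(g # xs) ! t \<in> carrier G" using Cons.prems nth_mem by blast
    from rho[OF this] show "1 / (8 * 2 ^ t) \<le> rho (n * m + n * m)
        (mix_mat n m (\<phi> ((g # xs) ! t)) (\<psi> ((g # xs) ! t)) - 1\<^sub>m (n * m + n * m))"
    proof (cases t)
      case 0
      then show ?thesis using rho[of g] g t Cons.prems rho_nonneg[of m "\<psi> g - 1\<^sub>m m"] by simp
    next
      case (Suc s)
      then have "1 / (8 * 2 ^ s) \<le> rho m (\<psi> (xs ! s) - 1\<^sub>m m)" using sep t by (simp add: separates_def)
      moreover have "xs ! s \<in> carrier G" using Suc t Cons.prems by auto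
      ultimately show ?thesis using Suc rho[of "xs ! s"] rho_nonneg[of n "\<phi> (xs ! s) - 1\<^sub>m n"] by simp
    qed
  qed
  moreover have "N \<le> n * m + n * m" using m nm by (metis le_add1 mult_le_mono1 mult_1 Suc_leI One_nat_def le_trans)
  ultimately show ?case using almost_rep_mix[OF G F \<phi> \<psi>] by blast
qed

subsection \<open>The metric ultraproduct\<close>

lemma GLprod_carrier_iff: "a \<in> carrier (GLprod n) \<longleftrightarrow> (\<forall>k. a k \<in> GL_mat (n k))"
  by (simp add: GLprod_def GL_mat_def)

lemma GLprod_mult [simp]: "a \<otimes>\<^bsub>GLprod n\<^esub> b = (\<lambda>k. a k * b k)"
  by (simp add: GLprod_def)

lemma GLprod_one [simp]: "\<one>\<^bsub>GLprod n\<^esub> = (\<lambda>k. 1\<^sub>m (n k))"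
  by (simp add: GLprod_def)

lemma GLprod_carrier_mat: "a \<in> carrier (GLprod n) \<Longrightarrow> a k \<in> carrier_mat (n k) (n k)"
  by (simp add: GLprod_carrier_iff GL_mat_carrier)

lemma group_GLprod: "group (GLprod n)"
proof (rule groupI)
  fix a b c assume "a \<in> carrier (GLprod n)" "b \<in> carrier (GLprod n)" "c \<in> carrier (GLprod n)"
  note abc = this[THEN GLprod_carrier_mat]
  show "a \<otimes>\<^bsub>GLprod n\<^esub> b \<otimes>\<^bsub>GLprod n\<^esub> c = a \<otimes>\<^bsub>GLprod n\<^esub> (b \<otimes>\<^bsub>GLprod n\<^esub> c)"
    using assoc_mult_mat[OF abc] by simp
next
  fix a assume a: "a \<in> carrier (GLprod n)"
  then have "\<forall>k. \<exists>b. b \<in> GL_mat (n k) \<and> b * a k = 1\<^sub>m (n k)"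
    by (metis GLprod_carrier_iff GL_mat_inverse)
  then obtain b where "\<And>k. b k \<in> GL_mat (n k)" "\<And>k. b k * a k = 1\<^sub>m (n k)" by metis
  then show "\<exists>b \<in> carrier (GLprod n). b \<otimes>\<^bsub>GLprod n\<^esub> a = \<one>\<^bsub>GLprod n\<^esub>"
    by (intro bexI[of _ b]) (auto simp: GLprod_carrier_iff)
  show "\<one>\<^bsub>GLprod n\<^esub> \<otimes>\<^bsub>GLprod n\<^esub> a = a"
    using left_mult_one_mat[OF GLprod_carrier_mat[OF a]] by simp
qed (auto simp: GLprod_carrier_iff GL_mat_mult GL_mat_one)

lemma rho_mult_diff_right_le:
  assumes "a \<in> carrier_mat n n" "c \<in> carrier_mat n n" "b \<in> carrier_mat n n"
  shows "rho n (a * b - c * b) \<le> rho n (a - c)"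
  using rho_mult_le_left[OF minus_carrier_mat[OF assms(2)] assms(3), of a] minus_mult_distrib_mat[OF assms] by simp

lemma rho_mult_diff_left_le:
  assumes "b \<in> carrier_mat n n" "a \<in> carrier_mat n n" "c \<in> carrier_mat n n"
  shows "rho n (b * a - b * c) \<le> rho n (a - c)"
  using rho_mult_le_right[OF assms(1) minus_carrier_mat[OF assms(3)], of a] mult_minus_distrib_mat[OF assms] by simp

lemma tendsto_zero_rho_le:
  assumes "(g \<longlongrightarrow> (0::real)) \<omega>" "\<And>k. rho (n k) (a k) \<le> g k"
  shows "((\<lambda>k. rho (n k) (a k)) \<longlongrightarrow> 0) \<omega>"
  by (rule tendsto_sandwich[OF _ _ tendsto_const assms(1)]) (auto simp: rho_nonneg assms(2))

text \<open>The closure properties come from three identities together with rank not increasing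
  under multiplication: a^-1 - 1 = (1 - a) a^-1, a b - 1 = (a - 1) b + (b - 1), and x h x^-1 - 1 = x
  (h - 1) x^-1.\<close>

lemma normal_d_kernel: "d_kernel n \<omega> \<lhd> GLprod n"
proof -
  interpret P: group "GLprod n" by (rule group_GLprod)
  let ?lim = "\<lambda>a. ((\<lambda>k. rho (n k) (a k - 1\<^sub>m (n k))) \<longlongrightarrow> 0) \<omega>"
  have inv: "inv\<^bsub>GLprod n\<^esub> a \<in> carrier (GLprod n) \<and> a k * (inv\<^bsub>GLprod n\<^esub> a) k = 1\<^sub>m (n k)
      \<and> (inv\<^bsub>GLprod n\<^esub> a) k * a k = 1\<^sub>m (n k)" if "a \<in> carrier (GLprod n)" for a k
    using P.r_inv[OF that] P.l_inv[OF that] P.inv_closed[OF that] by (simp add: fun_eq_iff)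
  have "subgroup (d_kernel n \<omega>) (GLprod n)"
  proof (rule P.subgroupI)
    show "d_kernel n \<omega> \<subseteq> carrier (GLprod n)" by (auto simp: d_kernel_def)
    have "\<one>\<^bsub>GLprod n\<^esub> \<in> d_kernel n \<omega>"
      using P.one_closed by (simp add: d_kernel_def diff_self_mat[OF one_carrier_mat])
    then show "d_kernel n \<omega> \<noteq> {}" by blast
  next
    fix a assume "a \<in> d_kernel n \<omega>"
    then have a: "a \<in> carrier (GLprod n)" and lim: "?lim a" by (auto simp: d_kernel_def)
    have "?lim (inv\<^bsub>GLprod n\<^esub> a)"
    proof (rule tendsto_zero_rho_le[OF lim])
      fix k
      note i = inv[OF a, of k]
      have c: "a k \<in> carrier_mat (n k) (n k)" "(inv\<^bsub>GLprod n\<^esub> a) k \<in> carrier_mat (n k) (n k)"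
        using GLprod_carrier_mat[OF a] GLprod_carrier_mat[OF conjunct1[OF i]] by blast+
      have "rho (n k) ((inv\<^bsub>GLprod n\<^esub> a) k - 1\<^sub>m (n k)) = rho (n k) (1\<^sub>m (n k) * (inv\<^bsub>GLprod n\<^esub> a) k - a k * (inv\<^bsub>GLprod n\<^esub> a) k)"
        using i c by simp
      also have "\<dots> \<le> rho (n k) (1\<^sub>m (n k) - a k)" using c by (intro rho_mult_diff_right_le) auto
      also have "\<dots> = rho (n k) (a k - 1\<^sub>m (n k))" using c by (intro rho_minus_commute) auto
      finally show "rho (n k) ((inv\<^bsub>GLprod n\<^esub> a) k - 1\<^sub>m (n k)) \<le> rho (n k) (a k - 1\<^sub>m (n k))" .
    qed
    then show "inv\<^bsub>GLprod n\<^esub> a \<in> d_kernel n \<omega>" using inv[OF a] by (simp add: d_kernel_def)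
  next
    fix a b assume "a \<in> d_kernel n \<omega>" "b \<in> d_kernel n \<omega>"
    then have a: "a \<in> carrier (GLprod n)" "?lim a" and b: "b \<in> carrier (GLprod n)" "?lim b"
      by (auto simp: d_kernel_def)
    have "?lim (\<lambda>k. a k * b k)"
    proof (rule tendsto_zero_rho_le)
      show "((\<lambda>k. rho (n k) (a k - 1\<^sub>m (n k)) + rho (n k) (b k - 1\<^sub>m (n k))) \<longlongrightarrow> 0) \<omega>"
        using tendsto_add[OF a(2) b(2)] by simp
      fix k
      note c = GLprod_carrier_mat[OF a(1), of k] GLprod_carrier_mat[OF b(1), of k]
      have "rho (n k) (a k * b k - 1\<^sub>m (n k)) \<le> rho (n k) (a k * b k - 1\<^sub>m (n k) * b k) + rho (n k) (b k - 1\<^sub>m (n k))"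
        using c rho_diff_triangle[OF mult_carrier_mat[OF c] c(2) one_carrier_mat] by simp
      also have "rho (n k) (a k * b k - 1\<^sub>m (n k) * b k) \<le> rho (n k) (a k - 1\<^sub>m (n k))"
        using c by (intro rho_mult_diff_right_le) auto
      finally show "rho (n k) (a k * b k - 1\<^sub>m (n k)) \<le> rho (n k) (a k - 1\<^sub>m (n k)) + rho (n k) (b k - 1\<^sub>m (n k))"
        by simp
    qed
    then show "a \<otimes>\<^bsub>GLprod n\<^esub> b \<in> d_kernel n \<omega>"
      using P.m_closed[OF a(1) b(1)] by (simp add: d_kernel_def)
  qed
  moreover have "x \<otimes>\<^bsub>GLprod n\<^esub> h \<otimes>\<^bsub>GLprod n\<^esub> inv\<^bsub>GLprod n\<^esub> x \<in> d_kernel n \<omega>"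
    if x: "x \<in> carrier (GLprod n)" and h: "h \<in> d_kernel n \<omega>" for x h
  proof -
    from h have h: "h \<in> carrier (GLprod n)" "?lim h" by (auto simp: d_kernel_def)
    have "?lim (\<lambda>k. x k * h k * (inv\<^bsub>GLprod n\<^esub> x) k)"
    proof (rule tendsto_zero_rho_le[OF h(2)])
      fix k
      note i = inv[OF x, of k]
      have c: "x k \<in> carrier_mat (n k) (n k)" "h k \<in> carrier_mat (n k) (n k)"
        "(inv\<^bsub>GLprod n\<^esub> x) k \<in> carrier_mat (n k) (n k)"
        using GLprod_carrier_mat[OF x] GLprod_carrier_mat[OF h(1)] GLprod_carrier_mat[OF conjunct1[OF i]] by blast+
      have "rho (n k) (x k * h k * (inv\<^bsub>GLprod n\<^esub> x) k - 1\<^sub>m (n k))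
          = rho (n k) (x k * h k * (inv\<^bsub>GLprod n\<^esub> x) k - x k * 1\<^sub>m (n k) * (inv\<^bsub>GLprod n\<^esub> x) k)"
        using i right_mult_one_mat[OF c(1)] by simp
      also have "\<dots> \<le> rho (n k) (x k * h k - x k * 1\<^sub>m (n k))"
        by (rule rho_mult_diff_right_le[OF mult_carrier_mat[OF c(1,2)] mult_carrier_mat[OF c(1) one_carrier_mat] c(3)])
      also have "\<dots> \<le> rho (n k) (h k - 1\<^sub>m (n k))"
        by (rule rho_mult_diff_left_le[OF c(1,2) one_carrier_mat])
      finally show "rho (n k) (x k * h k * (inv\<^bsub>GLprod n\<^esub> x) k - 1\<^sub>m (n k)) \<le> rho (n k) (h k - 1\<^sub>m (n k))" .
    qed
    then show ?thesis
      using P.m_closed[OF P.m_closed[OF x h(1)] P.inv_closed[OF x]] by (simp add: d_kernel_def)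
  qed
  ultimately show ?thesis by (auto simp: P.normal_inv_iff)
qed

section \<open>Passing between embeddings and almost representations\<close>

lemma eventually_ultrafilter_not:
  "nonprincipal_ultrafilter \<omega> \<Longrightarrow> \<not> eventually P \<omega> \<Longrightarrow> eventually (\<lambda>x. \<not> P x) \<omega>"
  by (auto simp: nonprincipal_ultrafilter_def)

text \<open>If some singleton were \<omega>-large, \<omega> would be the principal filter at that
  point. So every point, and hence every initial segment, can be discarded, which transfers ordinary
  limits and statements about all late k to \<omega>.\<close>

lemma nonprincipal_ultrafilter_le_sequentially:
  assumes "nonprincipal_ultrafilter \<omega>"
  shows "\<omega> \<le> sequentially"
proof -
  have "eventually (\<lambda>k. k \<noteq> x) \<omega>" for x
  proof (rule ccontr)
    assume "\<not> eventually (\<lambda>k. k \<noteq> x) \<omega>"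
    then have x: "eventually (\<lambda>k. k = x) \<omega>" using eventually_ultrafilter_not[OF assms] by fastforce
    have "eventually P \<omega> \<longleftrightarrow> P x" for P
    proof
      assume "eventually P \<omega>"
      then have "eventually (\<lambda>k. P k \<and> k = x) \<omega>" using x by (rule eventually_conj)
      then show "P x" using eventually_happens'[of \<omega>] assms by (auto simp: nonprincipal_ultrafilter_def)
    next
      assume "P x"
      with x show "eventually P \<omega>" by (auto elim: eventually_mono)
    qed
    then have "\<omega> = principal {x}" by (auto simp: filter_eq_iff eventually_principal)
    then show False using assms by (auto simp: nonprincipal_ultrafilter_def)
  qed
  then have "eventually (\<lambda>k. \<forall>x\<in>{..<N}. k \<noteq> x) \<omega>" for N by (intro eventually_ball_finite) auto
  then have "eventually (\<lambda>k. N \<le> k) \<omega>" for N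
    by (rule eventually_mono[of "\<lambda>k. \<forall>x\<in>{..<N}. k \<noteq> x"]) (metis lessThan_iff not_le)
  then show ?thesis by (simp add: le_sequentially)
qed

text \<open>Representatives of the cosets \<open>h x\<close> are multiplicative up to a defect
  tending to 0 along \<omega>. Amplification then replaces the unknown distance of g from 1 by the
  universal constant 1/4, and this uniformity in the group is what the passage to the limit
  needs.\<close>

lemma linear_sofic_almost_rep:
  assumes sofic: "linear_sofic G" and g: "g \<in> carrier G" "g \<noteq> \<one>\<^bsub>G\<^esub>"
    and F: "finite F" "F \<subseteq> carrier G" and \<epsilon>: "\<epsilon> > 0"
  shows "\<exists>n \<phi>. almost_rep G F \<epsilon> n \<phi> \<and> rho n (\<phi> g - 1\<^sub>m n) \<ge> 1/4"
proof -
  from sofic obtain \<omega> n h where G: "group G" and \<omega>: "nonprincipal_ultrafilter \<omega>"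
    and h: "h \<in> hom G (GL_ultraproduct n \<omega>)" and inj: "inj_on h (carrier G)"
    by (auto simp: linear_sofic_def)
  interpret G: group G by (rule G)
  interpret K: normal "d_kernel n \<omega>" "GLprod n" by (rule normal_d_kernel)
  interpret Q: group "GL_ultraproduct n \<omega>"
    unfolding GL_ultraproduct_def by (rule K.factorgroup_is_group)
  interpret h: group_hom G "GL_ultraproduct n \<omega>" h by unfold_locales (rule h)
  have sub: "subgroup (d_kernel n \<omega>) (GLprod n)" by (rule K.subgroup_axioms)
  let ?cos = "\<lambda>a. d_kernel n \<omega> #>\<^bsub>GLprod n\<^esub> a"
  have "\<exists>a. a \<in> carrier (GLprod n) \<and> h x = ?cos a" if "x \<in> carrier G" for x
    using h.hom_closed[OF that] by (auto simp: GL_ultraproduct_def FactGroup_def RCOSETS_def)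
  then obtain \<phi> where \<phi>: "\<And>x. x \<in> carrier G \<Longrightarrow> \<phi> x \<in> carrier (GLprod n)"
    and h\<phi>: "\<And>x. x \<in> carrier G \<Longrightarrow> h x = ?cos (\<phi> x)" by metis
  note c = GLprod_carrier_mat[OF \<phi>]
  have lim: "((\<lambda>k. rho (n k) (\<phi> x k * \<phi> y k - \<phi> (x \<otimes>\<^bsub>G\<^esub> y) k)) \<longlongrightarrow> 0) \<omega>"
    if x: "x \<in> carrier G" and y: "y \<in> carrier G" for x y
  proof -
    have "h (x \<otimes>\<^bsub>G\<^esub> y) = h x <#>\<^bsub>GLprod n\<^esub> h y"
      using h.hom_mult[OF x y] by (simp add: GL_ultraproduct_def FactGroup_def)
    then have "?cos (\<phi> (x \<otimes>\<^bsub>G\<^esub> y)) = ?cos (\<phi> x \<otimes>\<^bsub>GLprod n\<^esub> \<phi> y)"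
      using x y K.rcos_sum[OF \<phi> \<phi>] by (simp add: h\<phi>)
    then have "\<phi> x \<otimes>\<^bsub>GLprod n\<^esub> \<phi> y \<in> ?cos (\<phi> (x \<otimes>\<^bsub>G\<^esub> y))"
      using K.rcos_self[OF _ sub, of "\<phi> x \<otimes>\<^bsub>GLprod n\<^esub> \<phi> y"] K.m_closed[OF \<phi>[OF x] \<phi>[OF y]] by simp
    then obtain z where z: "z \<in> d_kernel n \<omega>" and eq: "\<phi> x \<otimes>\<^bsub>GLprod n\<^esub> \<phi> y = z \<otimes>\<^bsub>GLprod n\<^esub> \<phi> (x \<otimes>\<^bsub>G\<^esub> y)"
      unfolding r_coset_def by blast
    from eq have eq: "\<phi> x k * \<phi> y k = z k * \<phi> (x \<otimes>\<^bsub>G\<^esub> y) k" for k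
      by (simp only: GLprod_mult fun_eq_iff)
    have zc: "z \<in> carrier (GLprod n)" and zlim: "((\<lambda>k. rho (n k) (z k - 1\<^sub>m (n k))) \<longlongrightarrow> 0) \<omega>"
      using z unfolding d_kernel_def by blast+
    show ?thesis
    proof (rule tendsto_zero_rho_le[OF zlim])
      fix k
      have "rho (n k) (\<phi> x k * \<phi> y k - \<phi> (x \<otimes>\<^bsub>G\<^esub> y) k)
          = rho (n k) (z k * \<phi> (x \<otimes>\<^bsub>G\<^esub> y) k - 1\<^sub>m (n k) * \<phi> (x \<otimes>\<^bsub>G\<^esub> y) k)"
        unfolding eq using left_mult_one_mat[OF c[OF G.m_closed[OF x y]]] by simp
      also have "\<dots> \<le> rho (n k) (z k - 1\<^sub>m (n k))"
        by (rule rho_mult_diff_right_le[OF GLprod_carrier_mat[OF zc] one_carrier_mat c[OF G.m_closed[OF x y]]])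
      finally show "rho (n k) (\<phi> x k * \<phi> y k - \<phi> (x \<otimes>\<^bsub>G\<^esub> y) k) \<le> rho (n k) (z k - 1\<^sub>m (n k))" .
    qed
  qed
  have "\<not> ((\<lambda>k. rho (n k) (\<phi> g k - 1\<^sub>m (n k))) \<longlongrightarrow> 0) \<omega>"
  proof
    assume "((\<lambda>k. rho (n k) (\<phi> g k - 1\<^sub>m (n k))) \<longlongrightarrow> 0) \<omega>"
    then have "\<phi> g \<in> d_kernel n \<omega>" using \<phi>[OF g(1)] unfolding d_kernel_def by blast
    then have "h g = d_kernel n \<omega>" using K.coset_join2[OF \<phi>[OF g(1)] sub] h\<phi>[OF g(1)] by simp
    also have "\<dots> = h \<one>\<^bsub>G\<^esub>" using h.hom_one by (simp add: GL_ultraproduct_def FactGroup_def)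
    finally show False using inj g by (meson G.one_closed inj_onD)
  qed
  \<comment> \<open>Failure of convergence only says that the set where the distance is below
    \<delta> is not \<omega>-large; the ultrafilter property makes its complement large.\<close>
  then obtain \<delta> where \<delta>: "\<delta> > 0" and "\<not> eventually (\<lambda>k. dist (rho (n k) (\<phi> g k - 1\<^sub>m (n k))) 0 < \<delta>) \<omega>"
    by (auto simp: tendsto_iff)
  then have ev1: "eventually (\<lambda>k. rho (n k) (\<phi> g k - 1\<^sub>m (n k)) \<ge> \<delta>) \<omega>"
    using eventually_ultrafilter_not[OF \<omega>] by (fastforce simp: rho_nonneg not_less)
  \<comment> \<open>M depends on \<delta> alone, so the tolerance \<epsilon> / 2^M can still be
    imposed on an \<omega>-large set of indices.\<close>
  obtain M where "(3/2) ^ M > 1 / (4 * \<delta>)" using real_arch_pow[of "3/2"] by auto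
  then have M: "(3/2) ^ M * \<delta> \<ge> 1/4" using \<delta> by (simp add: field_simps)
  have ev2: "eventually (\<lambda>k. \<forall>x\<in>F. \<forall>y\<in>F. rho (n k) (\<phi> x k * \<phi> y k - \<phi> (x \<otimes>\<^bsub>G\<^esub> y) k) < \<epsilon> / 2 ^ M) \<omega>"
    using F \<epsilon> by (intro eventually_ball_finite ballI order_tendstoD(2)[OF lim]) auto
  have "\<omega> \<noteq> bot" using \<omega> by (simp add: nonprincipal_ultrafilter_def)
  then obtain k where
    k: "\<forall>x\<in>F. \<forall>y\<in>F. rho (n k) (\<phi> x k * \<phi> y k - \<phi> (x \<otimes>\<^bsub>G\<^esub> y) k) < \<epsilon> / 2 ^ M"
       "rho (n k) (\<phi> g k - 1\<^sub>m (n k)) \<ge> \<delta>"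
    using eventually_happens'[OF _ eventually_conj[OF ev2 ev1]] by metis
  \<comment> \<open>In dimension 0 division by zero gives \<open>rho\<close> the value 0,
    contradicting the lower bound \<delta>.\<close>
  have "n k > 0" using k(2) \<delta> by (cases "n k = 0") (auto simp: rho_def)
  then have "almost_rep G F (\<epsilon> / 2 ^ M) (n k) (\<lambda>x. \<phi> x k)"
    using k(1) \<phi> unfolding almost_rep_def GLprod_carrier_iff by (auto intro: less_imp_le)
  from almost_rep_amplify[OF G.is_monoid F(2) g(1) _ this k(2) M] \<epsilon> show ?thesis by simp
qed

text \<open>A diagonal argument along an enumeration of G: stage k handles the elements 0, ..., k
  with defect 1/(k+1) in dimension at least k. Since the separation bound of the t-th element does
  not change with k, it survives in the limit. Any nonprincipal \<omega> will do, as the estimates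
  hold for all late k.\<close>

lemma linear_sofic_of_almost_reps:
  assumes G: "group G" and count: "countable (carrier G)" and \<omega>: "nonprincipal_ultrafilter \<omega>"
    and reps: "\<And>F xs \<epsilon> N. finite F \<Longrightarrow> F \<subseteq> carrier G \<Longrightarrow> set xs \<subseteq> carrier G \<Longrightarrow> \<epsilon> > 0 \<Longrightarrow>
      \<exists>n \<phi>. n \<ge> N \<and> almost_rep G F \<epsilon> n \<phi> \<and> separates G xs n \<phi>"
  shows "linear_sofic G"
proof -
  interpret G: group G by (rule G)
  define e where "e = from_nat_into (carrier G)"
  \<comment> \<open>The enumeration may repeat elements, for instance when G is finite; only its
    surjectivity matters.\<close>
  have e: "e t \<in> carrier G" for t unfolding e_def using G.one_closed by (intro from_nat_into) auto
  have e_surj: "\<exists>t. x = e t" if "x \<in> carrier G" for x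
    unfolding e_def using from_nat_into_surj[OF count that] by metis
  have "\<exists>n \<phi>. n \<ge> k \<and> almost_rep G (e ` {..k}) (inverse (real (Suc k))) n \<phi> \<and> separates G (map e [0..<Suc k]) n \<phi>" for k
    using e by (intro reps) auto
  then obtain n \<phi> where n: "\<And>k. n k \<ge> k" and rep: "\<And>k. almost_rep G (e ` {..k}) (inverse (real (Suc k))) (n k) (\<phi> k)"
    and sep: "\<And>k. separates G (map e [0..<Suc k]) (n k) (\<phi> k)" by metis
  define \<Phi> where "\<Phi> = (\<lambda>x k. \<phi> k x)"
  interpret K: normal "d_kernel n \<omega>" "GLprod n" by (rule normal_d_kernel)
  interpret Q: group "GL_ultraproduct n \<omega>"
    unfolding GL_ultraproduct_def by (rule K.factorgroup_is_group)
  have sub: "subgroup (d_kernel n \<omega>) (GLprod n)" by (rule K.subgroup_axioms)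
  define h where "h x = d_kernel n \<omega> #>\<^bsub>GLprod n\<^esub> \<Phi> x" for x
  have \<Phi>: "\<Phi> x \<in> carrier (GLprod n)" if "x \<in> carrier G" for x
    using rep that by (auto simp: almost_rep_def GLprod_carrier_iff \<Phi>_def)
  have late: "eventually (\<lambda>k. N \<le> k) \<omega>" for N
    using nonprincipal_ultrafilter_le_sequentially[OF \<omega>] by (simp add: le_sequentially)
  have hom: "h (x \<otimes>\<^bsub>G\<^esub> y) = h x <#>\<^bsub>GLprod n\<^esub> h y" if x: "x \<in> carrier G" and y: "y \<in> carrier G" for x y
  proof -
    let ?p = "\<Phi> x \<otimes>\<^bsub>GLprod n\<^esub> \<Phi> y" and ?q = "\<Phi> (x \<otimes>\<^bsub>G\<^esub> y)"
    let ?r = "inv\<^bsub>GLprod n\<^esub> ?q"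
    have p: "?p \<in> carrier (GLprod n)" and q: "?q \<in> carrier (GLprod n)"
      using K.m_closed[OF \<Phi> \<Phi>] x y \<Phi> by auto
    have r: "?r \<in> carrier (GLprod n)" using q by (rule K.inv_closed)
    \<comment> \<open>z is the failure of multiplicativity as a group element, and z - 1 = (p - q)
      q^-1 turns the additive defect of the almost representations into membership in the
      kernel.\<close>
    define z where "z = ?p \<otimes>\<^bsub>GLprod n\<^esub> ?r"
    have zc: "z \<in> carrier (GLprod n)" unfolding z_def by (rule K.m_closed[OF p r])
    obtain s t where st: "x = e s" "y = e t" using e_surj x y by metis
    have "((\<lambda>k. rho (n k) (z k - 1\<^sub>m (n k))) \<longlongrightarrow> 0) \<omega>"
    proof (rule tendsto_sandwich[where f="\<lambda>_. 0"])
      show "((\<lambda>k. inverse (real (Suc k))) \<longlongrightarrow> 0) \<omega>"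
        using LIMSEQ_inverse_real_of_nat nonprincipal_ultrafilter_le_sequentially[OF \<omega>] by (rule tendsto_mono[rotated])
      \<comment> \<open>From stage max s t on, both x and y belong to the finite set on which the
        defect is controlled.\<close>
      show "eventually (\<lambda>k. rho (n k) (z k - 1\<^sub>m (n k)) \<le> inverse (real (Suc k))) \<omega>"
        using late[of "max s t"]
      proof (rule eventually_mono)
        fix k assume k: "max s t \<le> k"
        have "z k - 1\<^sub>m (n k) = ?p k * ?r k - ?q k * ?r k"
          using K.r_inv[OF q] by (simp add: z_def fun_eq_iff)
        then have "rho (n k) (z k - 1\<^sub>m (n k)) \<le> rho (n k) (?p k - ?q k)"
          using rho_mult_diff_right_le[OF GLprod_carrier_mat[OF p] GLprod_carrier_mat[OF q] GLprod_carrier_mat[OF r], of k] by simp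
        also have "\<dots> \<le> inverse (real (Suc k))"
          using rep[of k] k st by (simp add: almost_rep_def \<Phi>_def)
        finally show "rho (n k) (z k - 1\<^sub>m (n k)) \<le> inverse (real (Suc k))" .
      qed
    qed (auto simp: rho_nonneg)
    then have "z \<in> d_kernel n \<omega>" using zc unfolding d_kernel_def by blast
    moreover have "?p = z \<otimes>\<^bsub>GLprod n\<^esub> ?q"
      by (rule iffD1[OF K.inv_solve_right[OF zc p q] z_def])
    ultimately have "?p \<in> d_kernel n \<omega> #>\<^bsub>GLprod n\<^esub> ?q" unfolding r_coset_def by blast
    then have "h (x \<otimes>\<^bsub>G\<^esub> y) = d_kernel n \<omega> #>\<^bsub>GLprod n\<^esub> ?p"
      unfolding h_def by (rule K.repr_independence[OF _ q sub])
    then show ?thesis unfolding h_def using K.rcos_sum[OF \<Phi>[OF x] \<Phi>[OF y]] by simp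
  qed
  have h: "h \<in> hom G (GL_ultraproduct n \<omega>)"
    using hom \<Phi> by (intro homI) (auto simp: h_def GL_ultraproduct_def FactGroup_def RCOSETS_def)
  have "inj_on h (carrier G)"
    unfolding inj_on_one_iff'[OF h G Q.is_group]
  proof (intro allI impI)
    fix x assume x: "x \<in> carrier G" and "h x = \<one>\<^bsub>GL_ultraproduct n \<omega>\<^esub>"
    then have "d_kernel n \<omega> #>\<^bsub>GLprod n\<^esub> \<Phi> x = d_kernel n \<omega>" by (simp add: h_def GL_ultraproduct_def FactGroup_def)
    then have "\<Phi> x \<in> d_kernel n \<omega>" by (rule K.coset_join1[OF _ \<Phi>[OF x] sub])
    then have lim: "((\<lambda>k. rho (n k) (\<phi> k x - 1\<^sub>m (n k))) \<longlongrightarrow> 0) \<omega>"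
      unfolding d_kernel_def \<Phi>_def by blast
    obtain t where t: "x = e t" using e_surj x by blast
    show "x = \<one>\<^bsub>G\<^esub>"
    proof (rule ccontr)
      assume "x \<noteq> \<one>\<^bsub>G\<^esub>"
      then have "1 / (8 * 2 ^ t) \<le> rho (n k) (\<phi> k x - 1\<^sub>m (n k))" if "t \<le> k" for k
        using sep[of k, unfolded separates_def, rule_format, of t] that t by (simp del: upt_Suc)
      then have "eventually (\<lambda>k. 1 / (8 * 2 ^ t) \<le> rho (n k) (\<phi> k x - 1\<^sub>m (n k))) \<omega>"
        by (rule eventually_mono[OF late[of t]])
      moreover have "eventually (\<lambda>k. rho (n k) (\<phi> k x - 1\<^sub>m (n k)) < 1 / (8 * 2 ^ t)) \<omega>"
        by (rule order_tendstoD(2)[OF lim]) simp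
      ultimately have "eventually (\<lambda>k. False) \<omega>" by eventually_elim simp
      then show False using \<omega> by (simp add: nonprincipal_ultrafilter_def)
    qed
  qed
  moreover have "filterlim n at_top sequentially"
    by (rule filterlim_at_top_mono[OF filterlim_ident]) (simp add: n)
  ultimately show ?thesis using G count \<omega> h unfolding linear_sofic_def by blast
qed

subsection \<open>Direct limits\<close>

locale directed_groups =
  fixes G :: "nat \<Rightarrow> 'a monoid" and f :: "nat \<Rightarrow> nat \<Rightarrow> 'a \<Rightarrow> 'a"
  assumes directed: "directed_system G f"
begin

abbreviation "L \<equiv> direct_limit G f"

abbreviation cls :: "nat \<Rightarrow> 'a \<Rightarrow> (nat \<times> 'a) set" where
  "cls i x \<equiv> dlim_rel G f `` {(i, x)}"

lemma group_G: "group (G i)"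
  using directed by (simp add: directed_system_def)

lemma monoid_G: "monoid (G i)"
  using group_G by (rule group.is_monoid)

lemma f_hom: "i \<le> j \<Longrightarrow> f i j \<in> hom (G i) (G j)"
  using directed by (simp add: directed_system_def)

lemma f_closed: "i \<le> j \<Longrightarrow> x \<in> carrier (G i) \<Longrightarrow> f i j x \<in> carrier (G j)"
  by (rule hom_in_carrier[OF f_hom])

lemma f_mult: "i \<le> j \<Longrightarrow> x \<in> carrier (G i) \<Longrightarrow> y \<in> carrier (G i) \<Longrightarrow>
    f i j (x \<otimes>\<^bsub>G i\<^esub> y) = f i j x \<otimes>\<^bsub>G j\<^esub> f i j y"
  by (rule hom_mult[OF f_hom])

lemma f_one: "i \<le> j \<Longrightarrow> f i j \<one>\<^bsub>G i\<^esub> = \<one>\<^bsub>G j\<^esub>"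
  by (rule hom_one[OF f_hom group_G group_G])

lemma f_id: "x \<in> carrier (G i) \<Longrightarrow> f i i x = x"
  using directed by (simp add: directed_system_def)

lemma f_comp: "i \<le> j \<Longrightarrow> j \<le> k \<Longrightarrow> x \<in> carrier (G i) \<Longrightarrow> f j k (f i j x) = f i k x"
  using directed unfolding directed_system_def by blast

lemma dlim_rel_iff: "((i, x), (j, y)) \<in> dlim_rel G f \<longleftrightarrow>
    x \<in> carrier (G i) \<and> y \<in> carrier (G j) \<and> (\<exists>k. i \<le> k \<and> j \<le> k \<and> f i k x = f j k y)"
  by (simp add: dlim_rel_def)

lemma f_eq_mono:
  assumes "x \<in> carrier (G i)" "y \<in> carrier (G j)" "f i k x = f j k y" "i \<le> k" "j \<le> k" "k \<le> l"
  shows "f i l x = f j l y"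
  using assms f_comp by metis

lemma equiv_dlim_rel: "equiv (SIGMA i:UNIV. carrier (G i)) (dlim_rel G f)"
proof (rule equivI)
  show "dlim_rel G f \<subseteq> (SIGMA i:UNIV. carrier (G i)) \<times> (SIGMA i:UNIV. carrier (G i))"
    by (auto simp: dlim_rel_def)
  show "refl_on (SIGMA i:UNIV. carrier (G i)) (dlim_rel G f)"
    by (rule refl_onI) (auto simp: dlim_rel_def)
  show "sym (dlim_rel G f)" by (rule symI) (force simp: dlim_rel_def)
  show "trans (dlim_rel G f)"
  proof (rule transI)
    fix p q r assume pq: "(p, q) \<in> dlim_rel G f" and qr: "(q, r) \<in> dlim_rel G f"
    obtain i x j y k z where e: "p = (i, x)" "q = (j, y)" "r = (k, z)" by (metis surj_pair)
    from pq obtain l where l: "x \<in> carrier (G i)" "y \<in> carrier (G j)" "i \<le> l" "j \<le> l" "f i l x = f j l y"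
      by (auto simp: e dlim_rel_iff)
    from qr obtain m where m: "z \<in> carrier (G k)" "j \<le> m" "k \<le> m" "f j m y = f k m z"
      by (auto simp: e dlim_rel_iff)
    have "f i (max l m) x = f j (max l m) y"
      by (rule f_eq_mono[OF l(1,2,5,3,4) max.cobounded1])
    also have "\<dots> = f k (max l m) z"
      by (rule f_eq_mono[OF l(2) m(1,4,2,3) max.cobounded2])
    finally show "(p, r) \<in> dlim_rel G f" using l m by (auto simp: e dlim_rel_iff intro!: exI[of _ "max l m"])
  qed
qed

lemma cls_eq_iff:
  assumes "x \<in> carrier (G i)" "y \<in> carrier (G j)"
  shows "cls i x = cls j y \<longleftrightarrow> (\<exists>k. i \<le> k \<and> j \<le> k \<and> f i k x = f j k y)"
  using eq_equiv_class_iff[OF equiv_dlim_rel, of "(i, x)" "(j, y)"] assms by (simp add: dlim_rel_iff)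

lemma cls_push: "i \<le> j \<Longrightarrow> x \<in> carrier (G i) \<Longrightarrow> cls j (f i j x) = cls i x"
  by (subst cls_eq_iff) (auto intro!: exI[of _ j] f_closed f_id)

lemma cls_in_carrier: "x \<in> carrier (G i) \<Longrightarrow> cls i x \<in> carrier L"
  by (auto simp: direct_limit_def intro!: quotientI)

lemma carrier_obtains_cls:
  assumes "A \<in> carrier L"
  obtains i x where "x \<in> carrier (G i)" "A = cls i x"
  using assms by (auto simp: direct_limit_def elim!: quotientE)

text \<open>A class represented at level i is represented at every later level, so finitely many
  classes share a level. Identities in the limit can then be checked inside a single
  \<open>G k\<close>.\<close>

lemma carrier_common_cls:
  assumes "finite S" "S \<subseteq> carrier L"
  obtains k where "\<forall>A\<in>S. \<exists>x \<in> carrier (G k). A = cls k x"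
proof -
  have "eventually (\<lambda>k. \<exists>x \<in> carrier (G k). A = cls k x) sequentially" if "A \<in> S" for A
  proof -
    have "A \<in> carrier L" using that assms(2) by blast
    then obtain i x where "x \<in> carrier (G i)" "A = cls i x" by (rule carrier_obtains_cls)
    then have "\<exists>x \<in> carrier (G k). A = cls k x" if "i \<le> k" for k
      using cls_push[OF that] f_closed[OF that] by metis
    then show ?thesis by (auto simp: eventually_sequentially)
  qed
  then have "eventually (\<lambda>k. \<forall>A\<in>S. \<exists>x \<in> carrier (G k). A = cls k x) sequentially"
    using assms(1) by (intro eventually_ball_finite) auto
  then show ?thesis using that eventually_happens'[OF sequentially_bot] by blast
qed

text \<open>Multiplication in \<open>direct_limit\<close> picks representatives by
  \<open>SOME\<close>; this gives access to whatever pair was picked.\<close>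

lemma cls_some_representative:
  assumes "x \<in> carrier (G i)"
  obtains i' x' where "(SOME p. p \<in> cls i x) = (i', x')" "x' \<in> carrier (G i')" "cls i' x' = cls i x"
proof -
  obtain i' x' where s: "(SOME p. p \<in> cls i x) = (i', x')" by (metis surj_pair)
  have "(i, x) \<in> cls i x" using assms equiv_class_self[OF equiv_dlim_rel, of "(i, x)"] by simp
  then have "(i', x') \<in> cls i x" using someI[of "\<lambda>p. p \<in> cls i x"] s by metis
  then have "((i, x), (i', x')) \<in> dlim_rel G f" by simp
  then have "cls i x = cls i' x'" "x' \<in> carrier (G i')"
    using equiv_class_eq[OF equiv_dlim_rel] by (auto simp: dlim_rel_iff)
  then show ?thesis using that s by metis
qed

text \<open>Independence of the chosen representatives: each agrees with x or y from some level on,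
  and beyond all these levels the two products coincide because the connecting maps are
  homomorphisms. A common level k suffices by \<open>carrier_common_cls\<close>.\<close>

lemma cls_mult:
  assumes x: "x \<in> carrier (G k)" and y: "y \<in> carrier (G k)"
  shows "cls k x \<otimes>\<^bsub>L\<^esub> cls k y = cls k (x \<otimes>\<^bsub>G k\<^esub> y)"
proof -
  obtain i x' where i: "(SOME p. p \<in> cls k x) = (i, x')" "x' \<in> carrier (G i)" "cls i x' = cls k x"
    using cls_some_representative[OF x] .
  obtain j y' where j: "(SOME p. p \<in> cls k y) = (j, y')" "y' \<in> carrier (G j)" "cls j y' = cls k y"
    using cls_some_representative[OF y] .
  define m where "m = max i j"
  have m: "i \<le> m" "j \<le> m" by (auto simp: m_def)
  have prod: "cls k x \<otimes>\<^bsub>L\<^esub> cls k y = cls m (f i m x' \<otimes>\<^bsub>G m\<^esub> f j m y')"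
    by (simp only: direct_limit_def monoid.simps i(1) j(1) m_def Let_def prod.case)
  obtain a where a: "i \<le> a" "k \<le> a" "f i a x' = f k a x"
    using i(3) cls_eq_iff[OF i(2) x] by blast
  obtain b where b: "j \<le> b" "k \<le> b" "f j b y' = f k b y"
    using j(3) cls_eq_iff[OF j(2) y] by blast
  define M where "M = max m (max a b)"
  have M: "m \<le> M" "a \<le> M" "b \<le> M" "k \<le> M" "i \<le> M" "j \<le> M" using m a b by (auto simp: M_def)
  have xc: "f i m x' \<in> carrier (G m)" "f j m y' \<in> carrier (G m)" using f_closed i(2) j(2) m by auto
  have "f m M (f i m x' \<otimes>\<^bsub>G m\<^esub> f j m y') = f i M x' \<otimes>\<^bsub>G M\<^esub> f j M y'"
    using f_mult[OF M(1) xc] f_comp m M(1) i(2) j(2) by simp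
  also have "f i M x' = f k M x" using f_eq_mono[OF i(2) x a(3,1,2) M(2)] .
  also have "f j M y' = f k M y" using f_eq_mono[OF j(2) y b(3,1,2) M(3)] .
  also have "f k M x \<otimes>\<^bsub>G M\<^esub> f k M y = f k M (x \<otimes>\<^bsub>G k\<^esub> y)" using f_mult[OF M(4) x y] by simp
  finally have "cls m (f i m x' \<otimes>\<^bsub>G m\<^esub> f j m y') = cls k (x \<otimes>\<^bsub>G k\<^esub> y)"
    using cls_eq_iff[OF monoid.m_closed[OF monoid_G xc] monoid.m_closed[OF monoid_G x y]] M(1,4) by blast
  then show ?thesis using prod by simp
qed

lemma cls_one: "cls k \<one>\<^bsub>G k\<^esub> = \<one>\<^bsub>L\<^esub>"
proof -
  have "cls k \<one>\<^bsub>G k\<^esub> = cls 0 \<one>\<^bsub>G 0\<^esub>"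
    using cls_push[of 0 k "\<one>\<^bsub>G 0\<^esub>"] monoid.one_closed[OF monoid_G, of 0] unfolding f_one[OF le0] by simp
  then show ?thesis by (simp only: direct_limit_def monoid.simps)
qed

lemma group_direct_limit: "group L"
proof (rule groupI)
  show "\<one>\<^bsub>L\<^esub> \<in> carrier L"
    using cls_in_carrier[OF monoid.one_closed[OF monoid_G, of 0]] unfolding cls_one .
next
  fix A B assume "A \<in> carrier L" "B \<in> carrier L"
  then have S: "finite {A, B}" "{A, B} \<subseteq> carrier L" by auto
  obtain k where "\<forall>D\<in>{A, B}. \<exists>x \<in> carrier (G k). D = cls k x"
    using carrier_common_cls[OF S] .
  then obtain x y where "x \<in> carrier (G k)" "y \<in> carrier (G k)" "A = cls k x" "B = cls k y"
    unfolding ball_simps by metis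
  then show "A \<otimes>\<^bsub>L\<^esub> B \<in> carrier L"
    by (simp add: cls_mult cls_in_carrier monoid.m_closed[OF monoid_G])
next
  fix A B C assume "A \<in> carrier L" "B \<in> carrier L" "C \<in> carrier L"
  then have S: "finite {A, B, C}" "{A, B, C} \<subseteq> carrier L" by auto
  obtain k where "\<forall>D\<in>{A, B, C}. \<exists>x \<in> carrier (G k). D = cls k x"
    using carrier_common_cls[OF S] .
  then obtain x y z where "x \<in> carrier (G k)" "y \<in> carrier (G k)" "z \<in> carrier (G k)"
    "A = cls k x" "B = cls k y" "C = cls k z"
    unfolding ball_simps by metis
  then show "A \<otimes>\<^bsub>L\<^esub> B \<otimes>\<^bsub>L\<^esub> C = A \<otimes>\<^bsub>L\<^esub> (B \<otimes>\<^bsub>L\<^esub> C)"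
    by (simp add: cls_mult monoid.m_closed[OF monoid_G] monoid.m_assoc[OF monoid_G])
next
  fix A assume "A \<in> carrier L"
  then obtain i x where x: "x \<in> carrier (G i)" "A = cls i x" by (rule carrier_obtains_cls)
  interpret Gi: group "G i" by (rule group_G)
  show "\<one>\<^bsub>L\<^esub> \<otimes>\<^bsub>L\<^esub> A = A"
    using x by (simp add: cls_one[of i, symmetric] cls_mult)
  show "\<exists>B \<in> carrier L. B \<otimes>\<^bsub>L\<^esub> A = \<one>\<^bsub>L\<^esub>"
    using x by (intro bexI[of _ "cls i (inv\<^bsub>G i\<^esub> x)"])
      (simp_all add: cls_mult cls_one cls_in_carrier)
qed

lemma countable_direct_limit:
  assumes "\<And>i. countable (carrier (G i))"
  shows "countable (carrier L)"
proof -
  have "carrier L = (\<lambda>p. dlim_rel G f `` {p}) ` (SIGMA i:UNIV. carrier (G i))"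
    by (auto simp: direct_limit_def quotient_def)
  then show ?thesis using assms by (simp add: countable_SIGMA)
qed

section \<open>Lifting finite parts of the limit to the groups of the system\<close>

text \<open>The local embedding of the limit into the system. Fix one representative of each class
  and push it forward to level j. The maps \<open>s j\<close> need not be homomorphisms, but each
  product relation and each inequality with the unit holds at all late levels, hence finitely many
  of them hold at once.\<close>

lemma direct_limit_lift:
  "\<exists>s. (\<forall>A\<in>carrier L. \<forall>j. s j A \<in> carrier (G j)) \<and>
     (\<forall>A\<in>carrier L. \<forall>B\<in>carrier L.
        eventually (\<lambda>j. s j (A \<otimes>\<^bsub>L\<^esub> B) = s j A \<otimes>\<^bsub>G j\<^esub> s j B) sequentially) \<and>
     (\<forall>A\<in>carrier L. A \<noteq> \<one>\<^bsub>L\<^esub> \<longrightarrow> eventually (\<lambda>j. s j A \<noteq> \<one>\<^bsub>G j\<^esub>) sequentially)"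
proof -
  have "\<forall>A. \<exists>i x. A \<in> carrier L \<longrightarrow> x \<in> carrier (G i) \<and> A = cls i x"
    using carrier_obtains_cls by metis
  then obtain lev r where r: "\<And>A. A \<in> carrier L \<Longrightarrow> r A \<in> carrier (G (lev A))"
    and cls_r: "\<And>A. A \<in> carrier L \<Longrightarrow> cls (lev A) (r A) = A" by metis
  \<comment> \<open>The unit is a default below the level of the representative; it keeps
    \<open>s j A\<close> in \<open>G j\<close> for all j, so that composing with an almost
    representation gives invertible values everywhere.\<close>
  define s where "s j A = (if lev A \<le> j then f (lev A) j (r A) else \<one>\<^bsub>G j\<^esub>)" for j A
  have closed: "s j A \<in> carrier (G j)" if "A \<in> carrier L" for A j
    using that r f_closed monoid.one_closed[OF monoid_G] by (simp add: s_def)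
  have cls_s: "cls j (s j A) = A" if "A \<in> carrier L" "lev A \<le> j" for A j
    using that cls_push[OF that(2) r[OF that(1)]] cls_r by (simp add: s_def)
  have push: "f j k (s j A) = s k A" if "A \<in> carrier L" "lev A \<le> j" "j \<le> k" for A j k
    using that f_comp[OF that(2,3) r[OF that(1)]] by (simp add: s_def)
  show ?thesis
  proof (intro exI[of _ s] conjI ballI allI impI closed)
    fix A B assume A: "A \<in> carrier L" and B: "B \<in> carrier L"
    define C where "C = A \<otimes>\<^bsub>L\<^esub> B"
    have C: "C \<in> carrier L" using A B group_direct_limit unfolding C_def by (simp add: group.is_monoid monoid.m_closed)
    \<comment> \<open>At this level all three representatives are available, but equality of classes
      only yields equality of elements at some later level k.\<close>
    define j where "j = max (lev A) (max (lev B) (lev C))"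
    have j: "lev A \<le> j" "lev B \<le> j" "lev C \<le> j" by (auto simp: j_def)
    have "cls j (s j C) = cls j (s j A \<otimes>\<^bsub>G j\<^esub> s j B)"
      using cls_mult[OF closed[OF A] closed[OF B], of j] cls_s A B C j C_def by simp
    then obtain k where k: "j \<le> k" "f j k (s j C) = f j k (s j A \<otimes>\<^bsub>G j\<^esub> s j B)"
      using cls_eq_iff[OF closed[OF C] monoid.m_closed[OF monoid_G closed[OF A] closed[OF B]], of j j] by auto
    have "s l C = s l A \<otimes>\<^bsub>G l\<^esub> s l B" if "k \<le> l" for l
    proof -
      have jl: "j \<le> l" using k that by simp
      have "f j l (s j C) = f j l (s j A \<otimes>\<^bsub>G j\<^esub> s j B)"
        using f_eq_mono[OF closed[OF C] monoid.m_closed[OF monoid_G closed[OF A] closed[OF B]] k(2) k(1) k(1) that] .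
      then show ?thesis using f_mult[OF jl closed[OF A] closed[OF B]] push jl A B C j by simp
    qed
    then show "eventually (\<lambda>j. s j (A \<otimes>\<^bsub>L\<^esub> B) = s j A \<otimes>\<^bsub>G j\<^esub> s j B) sequentially"
      unfolding C_def by (auto simp: eventually_sequentially)
  next
    fix A assume "A \<in> carrier L" "A \<noteq> \<one>\<^bsub>L\<^esub>"
    note A = this
    \<comment> \<open>At such a level \<open>s j A\<close> still represents A, so if it were the
      unit of \<open>G j\<close>, A would be the unit of the limit.\<close>
    have "s j A \<noteq> \<one>\<^bsub>G j\<^esub>" if "lev A \<le> j" for j
      using cls_s[OF A(1) that] A(2) cls_one by metis
    then show "eventually (\<lambda>j. s j A \<noteq> \<one>\<^bsub>G j\<^esub>) sequentially" by (auto simp: eventually_sequentially)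
  qed
qed

end

theorem mainTheorem15:
  fixes G :: "nat \<Rightarrow> 'a monoid" and f :: "nat \<Rightarrow> nat \<Rightarrow> 'a \<Rightarrow> 'a"
  assumes "directed_system G f"
    and "\<And>i. linear_sofic (G i)"
  shows "linear_sofic (direct_limit G f)"
proof -
  interpret directed_groups G f by (rule directed_groups.intro[OF assms(1)])
  obtain s where s: "\<forall>A\<in>carrier L. \<forall>j. s j A \<in> carrier (G j)"
    and s_mult: "\<forall>A\<in>carrier L. \<forall>B\<in>carrier L.
      eventually (\<lambda>j. s j (A \<otimes>\<^bsub>L\<^esub> B) = s j A \<otimes>\<^bsub>G j\<^esub> s j B) sequentially"
    and s_one: "\<forall>A\<in>carrier L. A \<noteq> \<one>\<^bsub>L\<^esub> \<longrightarrow> eventually (\<lambda>j. s j A \<noteq> \<one>\<^bsub>G j\<^esub>) sequentially"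
    using direct_limit_lift by (elim exE conjE)
  \<comment> \<open>The ultrafilter of the limit can be chosen freely; the one belonging to
    \<open>G 0\<close> is at hand.\<close>
  obtain \<omega> where \<omega>: "nonprincipal_ultrafilter \<omega>" using assms(2)[of 0] by (auto simp: linear_sofic_def)
  have count: "countable (carrier L)"
    using assms(2) by (intro countable_direct_limit) (simp add: linear_sofic_def)
  show ?thesis
  proof (rule linear_sofic_of_almost_reps[OF group_direct_limit count \<omega>])
    fix F :: "(nat \<times> 'a) set set" and xs :: "(nat \<times> 'a) set list" and \<epsilon> :: real and N :: nat
    assume F: "finite F" "F \<subseteq> carrier L" and xs: "set xs \<subseteq> carrier L" and \<epsilon>: "\<epsilon> > 0"
    have ev1: "eventually (\<lambda>j. \<forall>A\<in>F. \<forall>B\<in>F. s j (A \<otimes>\<^bsub>L\<^esub> B) = s j A \<otimes>\<^bsub>G j\<^esub> s j B) sequentially"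
      using F s_mult by (intro eventually_ball_finite ballI) auto
    have ev2: "eventually (\<lambda>j. \<forall>A\<in>set xs. A \<noteq> \<one>\<^bsub>L\<^esub> \<longrightarrow> s j A \<noteq> \<one>\<^bsub>G j\<^esub>) sequentially"
    proof (intro eventually_ball_finite ballI)
      fix A assume "A \<in> set xs"
      then show "eventually (\<lambda>j. A \<noteq> \<one>\<^bsub>L\<^esub> \<longrightarrow> s j A \<noteq> \<one>\<^bsub>G j\<^esub>) sequentially"
        using xs s_one by (cases "A = \<one>\<^bsub>L\<^esub>") auto
    qed simp
    obtain j where j: "\<forall>A\<in>F. \<forall>B\<in>F. s j (A \<otimes>\<^bsub>L\<^esub> B) = s j A \<otimes>\<^bsub>G j\<^esub> s j B"
      "\<forall>A\<in>set xs. A \<noteq> \<one>\<^bsub>L\<^esub> \<longrightarrow> s j A \<noteq> \<one>\<^bsub>G j\<^esub>"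
      using eventually_happens'[OF sequentially_bot eventually_conj[OF ev1 ev2]] by (elim exE conjE)
    \<comment> \<open>The level j depends on F and xs only; the defect \<epsilon> and the dimension
      bound N are then met inside this one group \<open>G j\<close>.\<close>
    have "s j ` F \<subseteq> carrier (G j)" "set (map (s j) xs) \<subseteq> carrier (G j)" using F xs s by auto
    then obtain n \<phi> where n: "n \<ge> N" and rep: "almost_rep (G j) (s j ` F) \<epsilon> n \<phi>"
      and sep: "separates (G j) (map (s j) xs) n \<phi>"
      using almost_rep_separates[OF monoid_G _ _ linear_sofic_almost_rep[OF assms(2)], of "s j ` F" j \<epsilon> "map (s j) xs" N] F \<epsilon>
      by auto
    \<comment> \<open>Pulling back along \<open>s j\<close> keeps the defect because
      \<open>s j\<close> is multiplicative on F, and keeps the separation bounds because mapping a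
      list preserves positions.\<close>
    have "almost_rep L F \<epsilon> n (\<lambda>A. \<phi> (s j A))"
      using rep s j(1) by (simp add: almost_rep_def)
    moreover have "separates L xs n (\<lambda>A. \<phi> (s j A))"
      using sep j(2) by (simp add: separates_def)
    ultimately show "\<exists>n \<phi>. n \<ge> N \<and> almost_rep L F \<epsilon> n \<phi> \<and> separates L xs n \<phi>" using n by blast
  qed
qed

end
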